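(* Let $f:\overline{\Omega}\times\mathbb{R}\to\mathbb{R}$ be continuous (jointly in both variables) and satisfy the following three conditions. (a) $\displaystyle\lim_{|s|\to\infty}\frac{\max_{x\in\overline{\Omega}}|f(x,s)|}{|s|^{2^*-1}}=0$. (b) There is a constant $c_0>0$ such that $\displaystyle\limsup_{s\to+\infty}\frac{\max_{\overline{\Omega}\times[-s,s]}|f|}{\max_{\overline{\Omega}\times\{-s,s\}}|f|}\le c_0$. (c) There are constants $M_0>0$ and $s_0>0$ such that $\max_{x\in\overline{\Omega}}|f(x,s)|>M_0$ for all $|s|>s_0$. Let $\{u_k\}\subset H_0^1(\Omega)\cap L^\infty(\Omega)$ be any sequence of weak solutions of $-\Delta u=f(x,u)$ in $\Omega$, $u=0$ on $\partial\Omega$, for which there is a constant $C_0>0$ with $\|u_k\|_{2^*}\le C_0$ for all $k$. Then there exists a constant $C>0$ such that $\|u_k\|_\infty\le C$ for all $k$.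
   Context: $N>2$; $\Omega\subset\mathbb{R}^N$ is a bounded, connected open set with $C^{2,\alpha}$ boundary $\partial\Omega$. $2^*=\frac{2N}{N-2}$ is the critical Sobolev exponent. $\|\cdot\|_p$ is the $L^p(\Omega)$ norm. A weak solution of $-\Delta u=f(x,u)$ in $\Omega$, $u=0$ on $\partial\Omega$, is a function $u\in H_0^1(\Omega)$ with $f(\cdot,u)\in L^1_{loc}(\Omega)$ and $\int_\Omega\nabla u\cdot\nabla\varphi\,dx=\int_\Omega f(x,u)\varphi\,dx$ for all $\varphi\in C_c^\infty(\Omega)$. No sign condition is imposed. *)

theory Defs
  imports "HOL-Analysis.Analysis" "HOL-Probability.Essential_Supremum"
begin

section \<open>Classical differentiability classes\<close>

definition partial_deriv :: "'a::euclidean_space \<Rightarrow> ('a \<Rightarrow> real) \<Rightarrow> 'a \<Rightarrow> real" where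
  "partial_deriv b f x = frechet_derivative f (at x) b"

definition grad :: "('a::euclidean_space \<Rightarrow> real) \<Rightarrow> 'a \<Rightarrow> 'a" where
  "grad f x = (\<Sum>b\<in>Basis. partial_deriv b f x *\<^sub>R b)"

primrec C_k :: "nat \<Rightarrow> ('a::euclidean_space \<Rightarrow> real) \<Rightarrow> bool" where
  "C_k 0 f = continuous_on UNIV f"
| "C_k (Suc k) f = ((\<forall>x. f differentiable (at x)) \<and> (\<forall>b\<in>Basis. C_k k (partial_deriv b f)))"

definition hoelder :: "real \<Rightarrow> ('a::euclidean_space \<Rightarrow> real) \<Rightarrow> bool" where
  "hoelder \<alpha> f \<longleftrightarrow> (\<exists>L. \<forall>x y. \<bar>f x - f y\<bar> \<le> L * dist x y powr \<alpha>)"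

definition C_2_hoelder :: "real \<Rightarrow> ('a::euclidean_space \<Rightarrow> real) \<Rightarrow> bool" where
  "C_2_hoelder \<alpha> f \<longleftrightarrow> C_k 2 f \<and>
     (\<forall>b\<in>Basis. \<forall>c\<in>Basis. hoelder \<alpha> (partial_deriv b (partial_deriv c f)))"

text \<open>
  Near each boundary point the set is the strict epigraph, in some unit direction \<open>\<nu>\<close>, of a
  \<open>C\<^sup>2\<^sup>,\<^sup>\<alpha>\<close> function of the remaining \<open>N - 1\<close> orthonormal coordinates. Such a function is given
  here as the restriction of a \<open>C\<^sup>2\<^sup>,\<^sup>\<alpha>\<close> function \<open>\<gamma>\<close> on the whole space to the hyperplane
  orthogonal to \<open>\<nu>\<close>. Taking \<open>\<gamma>\<close> to be globally \<open>C\<^sup>2\<^sup>,\<^sup>\<alpha>\<close> costs nothing, since a local graph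
  function can be cut off outside a neighbourhood of the boundary point.
\<close>
definition C_2_hoelder_boundary :: "real \<Rightarrow> 'a::euclidean_space set \<Rightarrow> bool" where
  "C_2_hoelder_boundary \<alpha> \<Omega> \<longleftrightarrow>
     (\<forall>p\<in>frontier \<Omega>. \<exists>r>0. \<exists>\<nu> \<gamma>. norm \<nu> = 1 \<and> C_2_hoelder \<alpha> \<gamma> \<and>
        \<Omega> \<inter> ball p r = {x \<in> ball p r. \<gamma> (x - (x \<bullet> \<nu>) *\<^sub>R \<nu>) < x \<bullet> \<nu>})"

definition test_functions :: "'a::euclidean_space set \<Rightarrow> ('a \<Rightarrow> real) set" where
  "test_functions \<Omega> = {\<phi>. (\<forall>k. C_k k \<phi>) \<and>
     compact (closure {x. \<phi> x \<noteq> 0}) \<and> closure {x. \<phi> x \<noteq> 0} \<subseteq> \<Omega>}"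


section \<open>Lebesgue and Sobolev spaces\<close>

definition Lp_norm :: "'a::euclidean_space set \<Rightarrow> real \<Rightarrow> ('a \<Rightarrow> 'b::euclidean_space) \<Rightarrow> ennreal" where
  "Lp_norm \<Omega> p u =
     (let I = (\<integral>\<^sup>+x. ennreal (norm (u x) powr p) \<partial>lebesgue_on \<Omega>)
      in if I = \<infinity> then \<infinity> else ennreal (enn2real I powr (1 / p)))"

definition Lp :: "'a::euclidean_space set \<Rightarrow> real \<Rightarrow> ('a \<Rightarrow> 'b::euclidean_space) set" where
  "Lp \<Omega> p = {u \<in> borel_measurable (lebesgue_on \<Omega>). Lp_norm \<Omega> p u < \<infinity>}"

definition Linf_norm :: "'a::euclidean_space set \<Rightarrow> ('a \<Rightarrow> real) \<Rightarrow> ennreal" where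
  "Linf_norm \<Omega> u = esssup (lebesgue_on \<Omega>) (\<lambda>x. ennreal \<bar>u x\<bar>)"

definition Linf :: "'a::euclidean_space set \<Rightarrow> ('a \<Rightarrow> real) set" where
  "Linf \<Omega> = {u \<in> borel_measurable (lebesgue_on \<Omega>). Linf_norm \<Omega> u < \<infinity>}"

definition L1_loc :: "'a::euclidean_space set \<Rightarrow> ('a \<Rightarrow> 'b::euclidean_space) set" where
  "L1_loc \<Omega> = {u. \<forall>K. compact K \<longrightarrow> K \<subseteq> \<Omega> \<longrightarrow> integrable (lebesgue_on K) u}"

text \<open>The weak gradient is a relation, as it is determined only almost everywhere.\<close>
definition has_weak_gradient ::
  "'a::euclidean_space set \<Rightarrow> ('a \<Rightarrow> real) \<Rightarrow> ('a \<Rightarrow> 'a) \<Rightarrow> bool" where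
  "has_weak_gradient \<Omega> u G \<longleftrightarrow> u \<in> L1_loc \<Omega> \<and> G \<in> L1_loc \<Omega> \<and>
     (\<forall>\<phi>\<in>test_functions \<Omega>. \<forall>b\<in>Basis.
        (LINT x|lebesgue_on \<Omega>. u x * partial_deriv b \<phi> x)
          = - (LINT x|lebesgue_on \<Omega>. (G x \<bullet> b) * \<phi> x))"

text \<open>\<open>H\<^sub>0\<^sup>1(\<Omega>)\<close>: the closure of the test functions in the norm of \<open>H\<^sup>1(\<Omega>)\<close>.\<close>
definition H10 :: "'a::euclidean_space set \<Rightarrow> ('a \<Rightarrow> real) set" where
  "H10 \<Omega> = {u \<in> Lp \<Omega> 2. \<exists>G\<in>Lp \<Omega> 2. has_weak_gradient \<Omega> u G \<and>
     (\<exists>\<phi>. (\<forall>k. \<phi> k \<in> test_functions \<Omega>) \<and>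
        (\<lambda>k::nat. Lp_norm \<Omega> 2 (\<lambda>x. \<phi> k x - u x)) \<longlonglongrightarrow> 0 \<and>
        (\<lambda>k. Lp_norm \<Omega> 2 (\<lambda>x. grad (\<phi> k) x - G x)) \<longlonglongrightarrow> 0)}"

definition weak_solution ::
  "'a::euclidean_space set \<Rightarrow> ('a \<Rightarrow> real \<Rightarrow> real) \<Rightarrow> ('a \<Rightarrow> real) \<Rightarrow> bool" where
  "weak_solution \<Omega> f u \<longleftrightarrow> u \<in> H10 \<Omega> \<and> (\<lambda>x. f x (u x)) \<in> L1_loc \<Omega> \<and>
     (\<exists>G. has_weak_gradient \<Omega> u G \<and>
        (\<forall>\<phi>\<in>test_functions \<Omega>.
           (LINT x|lebesgue_on \<Omega>. G x \<bullet> grad \<phi> x)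
             = (LINT x|lebesgue_on \<Omega>. f x (u x) * \<phi> x)))"

definition crit_exp :: "nat \<Rightarrow> real" where
  "crit_exp N = 2 * real N / (real N - 2)"

end

theory Submission
  imports Defs
begin

text \<open>
Let \<open>N\<close> be the dimension, \<open>q = 2N/(N - 2)\<close> the critical exponent and \<open>g\<^sub>k = f(\<cdot>, u\<^sub>k)\<close>. The bound
comes from testing the equation with functions of the solution itself. For \<open>\<Psi>\<close> with
\<open>\<Psi>(0) = 0\<close> put \<open>\<Phi>(0) = 0\<close>, \<open>\<Phi>' = (\<Psi>')\<^sup>2\<close>. Testing with \<open>\<Phi>(u)\<close> gives
\<open>\<integral>(\<Psi>'(u))\<^sup>2 |\<nabla>u|\<^sup>2 = \<integral>f(x, u) \<Phi>(u)\<close>. The left side is the Dirichlet integral of \<open>\<Psi>(u)\<close>, so the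
Sobolev inequality gives the estimate \<open>energy_inequality\<close>,
\<open>(\<integral>|\<Psi>(u)|\<^sup>q)\<^bsup>2/q\<^esup> \<le> S \<integral>f(x, u) \<Phi>(u)\<close>, with \<open>S\<close> depending only on \<open>N\<close>.
Everything after that is a choice of \<open>\<Psi>\<close>.

With \<open>\<Psi>(s) = s\<^sup>m\<close> the right side contains \<open>|f(x, u)| |u|\<^bsup>2m-1\<^esup>\<close>. By the growth condition
\<open>|f(x, s)| \<le> \<epsilon> |s|\<^bsup>q-1\<^esup>\<close> for large \<open>|s|\<close>, so this is at most
\<open>\<epsilon> |u|\<^bsup>q-2\<^esup> |u|\<^bsup>2m\<^esup>\<close> plus a constant. By Hoelder's inequality and the bound on \<open>u\<close> in
\<open>L\<^sup>q\<close>, its integral is at most a constant times \<open>\<epsilon>\<close> times the left side, and is absorbed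
there when \<open>\<epsilon>\<close> is small; absorption is legitimate since \<open>u\<close> is bounded and all integrals are finite. So for
every fixed \<open>m\<close> the norms of \<open>u\<^sub>k\<close> in \<open>L\<^bsup>qm\<^esup>\<close> are bounded uniformly in \<open>k\<close>
(\<open>powr_bound_of_critical_bound\<close>). For \<open>m = N\<close> this bounds \<open>g\<^sub>k\<close> in \<open>L\<^sup>N\<close>.

Since \<open>N > N/2\<close>, Stampacchia's method now applies (\<open>sup_bound_of_rhs_bound\<close>). With
\<open>w = (|u| - k)\<^sup>+\<close> and \<open>|\<Psi>(u)| = w\<^sup>2\<close> the energy inequality bounds the measure of \<open>{|u| > h}\<close>, for
\<open>h > k\<close>, by a power greater than 1 of the measure of \<open>{|u| > k}\<close>, with a factor that depends on \<open>h - k\<close>. A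
function with this property vanishes from some explicit level on.

The Sobolev inequality is derived from a product inequality for integrals along coordinate lines
(\<open>line_integrals_product_bound\<close>). The energy inequality is proved on smooth approximations of \<open>u\<close>, for which
the chain rule is the classical one, and passes to the limit by dominated convergence and Fatou's lemma.
\<close>


section \<open>Hoelder's inequality for extended nonnegative functions\<close>

text \<open>
A power with \<open>x\<^sup>0 = 1\<close> for every \<open>x\<close>, including \<open>0\<close> and \<open>\<infinity>\<close>. In
\<open>line_integrals_product_bound\<close> the exponent of \<open>f\<close> reaches \<open>0\<close>, where the factor has to disappear, whereas
\<open>0 powr 0 = 0\<close>.
\<close>
definition epow :: "ennreal \<Rightarrow> real \<Rightarrow> ennreal" where
  "epow x a = (if a = 0 then 1 else if x = \<infinity> then \<infinity> else ennreal (enn2real x powr a))"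

lemma epow_0 [simp]: "epow x 0 = 1"
  by (simp add: epow_def)

lemma epow_zero: "a \<noteq> 0 \<Longrightarrow> epow 0 a = 0"
  by (simp add: epow_def)

lemma epow_top: "a \<noteq> 0 \<Longrightarrow> epow top a = top"
  by (simp add: epow_def)

lemma epow_ennreal: "a \<noteq> 0 \<Longrightarrow> 0 \<le> r \<Longrightarrow> epow (ennreal r) a = ennreal (r powr a)"
  by (simp add: epow_def)

lemma epow_eq_0_iff: "a \<noteq> 0 \<Longrightarrow> epow x a = 0 \<longleftrightarrow> x = 0"
  by (cases x) (auto simp: epow_def)

lemma epow_add:
  assumes "0 \<le> a" "0 \<le> b"
  shows "epow x (a + b) = epow x a * epow x b"
proof (cases x)
  case (real r)
  then show ?thesis using assms
    by (auto simp: epow_def powr_add ennreal_mult')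
next
  case top
  then show ?thesis using assms by (auto simp: epow_def ennreal_mult_top)
qed

lemma epow_mono:
  assumes "x \<le> y" "0 \<le> a"
  shows "epow x a \<le> epow y a"
proof (cases y)
  case (real r)
  then have "x \<noteq> \<infinity>" "enn2real x \<le> r"
    using assms enn2real_mono[of x y] by (auto simp: top_unique)
  with real assms show ?thesis by (auto simp: epow_def intro!: ennreal_leI powr_mono2)
qed (use assms in \<open>auto simp: epow_def\<close>)

lemma measurable_epow [measurable (raw)]:
  assumes [measurable]: "f \<in> borel_measurable M"
  shows "(\<lambda>x. epow (f x) a) \<in> borel_measurable M"
  unfolding epow_def by measurable

text \<open>
Convexity of the exponential function at the points \<open>ln (y\<^sub>j)\<close>; if some \<open>y\<^sub>j\<close> vanishes, then so does the left side.
\<close>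
lemma weighted_AM_GM:
  fixes a y :: "'b \<Rightarrow> real"
  assumes "finite J" "\<And>j. j \<in> J \<Longrightarrow> 0 < a j" "(\<Sum>j\<in>J. a j) = 1" "\<And>j. j \<in> J \<Longrightarrow> 0 \<le> y j"
  shows "(\<Prod>j\<in>J. y j powr a j) \<le> (\<Sum>j\<in>J. a j * y j)"
proof (cases "\<exists>j\<in>J. y j = 0")
  case True
  then have "(\<Prod>j\<in>J. y j powr a j) = 0" using assms using assms(1) by (auto simp: prod_zero_iff)
  moreover have "0 \<le> (\<Sum>j\<in>J. a j * y j)" using assms by (intro sum_nonneg mult_nonneg_nonneg) (auto intro: less_imp_le)
  ultimately show ?thesis by simp
next
  case False
  then have pos: "\<And>j. j \<in> J \<Longrightarrow> 0 < y j" using assms by force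
  have ne: "J \<noteq> {}" using assms by auto
  have "exp (\<Sum>j\<in>J. a j *\<^sub>R ln (y j)) \<le> (\<Sum>j\<in>J. a j * exp (ln (y j)))"
    by (rule convex_on_sum[OF assms(1) ne exp_convex]) (use assms in \<open>auto intro: less_imp_le\<close>)
  also have "\<dots> = (\<Sum>j\<in>J. a j * y j)" using pos by (intro sum.cong) auto
  also have "exp (\<Sum>j\<in>J. a j *\<^sub>R ln (y j)) = (\<Prod>j\<in>J. y j powr a j)"
    using pos assms(1) by (subst exp_sum) (auto simp: powr_def intro!: prod.cong dest: pos)
  finally show ?thesis .
qed

lemma prod_ennreal_eq_top:
  fixes f :: "'b \<Rightarrow> ennreal"
  assumes "finite J" "j \<in> J" "f j = top" "\<And>i. i \<in> J \<Longrightarrow> f i \<noteq> 0"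
  shows "(\<Prod>i\<in>J. f i) = top"
proof -
  have "(\<Prod>i\<in>J. f i) = f j * (\<Prod>i\<in>J - {j}. f i)" using assms by (simp add: prod.remove)
  moreover have "(\<Prod>i\<in>J - {j}. f i) \<noteq> 0" using assms by (simp add: prod_zero_iff)
  ultimately show ?thesis using assms by (simp add: ennreal_top_mult)
qed

text \<open>
If every integral is positive and finite, division by the integrals reduces the claim to the pointwise
weighted inequality between geometric and arithmetic mean. If some integral vanishes then so does the integrand, almost
everywhere; otherwise, if some integral is infinite, the right-hand side is infinite.
\<close>
lemma Hoelder_ennreal_pos_exponents:
  fixes a :: "'b \<Rightarrow> real"
  assumes J: "finite J" and a: "\<And>j. j \<in> J \<Longrightarrow> 0 < a j" "(\<Sum>j\<in>J. a j) = 1"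
    and f: "\<And>j. j \<in> J \<Longrightarrow> f j \<in> borel_measurable M"
  shows "(\<integral>\<^sup>+x. (\<Prod>j\<in>J. epow (f j x) (a j)) \<partial>M) \<le> (\<Prod>j\<in>J. epow (\<integral>\<^sup>+x. f j x \<partial>M) (a j))"
proof (cases "\<exists>j\<in>J. (\<integral>\<^sup>+x. f j x \<partial>M) = 0")
  case True
  then obtain j where j: "j \<in> J" "(\<integral>\<^sup>+x. f j x \<partial>M) = 0" by auto
  then have "AE x in M. f j x = 0" using f by (subst (asm) nn_integral_0_iff_AE) auto
  then have "AE x in M. (\<Prod>j\<in>J. epow (f j x) (a j)) = 0"
    by eventually_elim (use j a J in \<open>auto intro!: prod_zero bexI[of _ j] epow_zero simp del: prod_zero_iff, force\<close>)
  then have "(\<integral>\<^sup>+x. (\<Prod>j\<in>J. epow (f j x) (a j)) \<partial>M) = (\<integral>\<^sup>+x. 0 \<partial>M)"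
    by (rule nn_integral_cong_AE)
  then show ?thesis by simp
next
  case False
  define I where "I j = (\<integral>\<^sup>+x. f j x \<partial>M)" for j
  have I0: "\<And>j. j \<in> J \<Longrightarrow> I j \<noteq> 0" using False by (auto simp: I_def)
  have a0: "\<And>j. j \<in> J \<Longrightarrow> a j \<noteq> 0" using a by force
  show ?thesis
  proof (cases "\<exists>j\<in>J. I j = top")
    case True
    then obtain j where j: "j \<in> J" "I j = top" by auto
    have "(\<Prod>j\<in>J. epow (I j) (a j)) = top"
      using J j by (rule_tac prod_ennreal_eq_top[of _ j]) (auto simp: epow_top a0 epow_eq_0_iff I0)
    then show ?thesis unfolding I_def by simp
  next
    case False
    define r where "r j = enn2real (I j)" for j
    have r: "I j = ennreal (r j)" "0 < r j" if "j \<in> J" for j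
    proof -
      show "I j = ennreal (r j)" using False that by (simp add: r_def ennreal_enn2real_if)
      then show "0 < r j" using I0[OF that] by (metis ennreal_eq_0_iff not_le)
    qed
    define P where "P = (\<Prod>j\<in>J. r j powr a j)"
    have P: "0 < P" unfolding P_def by (rule prod_pos) (use r in \<open>auto simp: powr_gt_zero dest: r(2)\<close>)
    have Pe: "(\<Prod>j\<in>J. epow (I j) (a j)) = ennreal P"
    proof -
      have "(\<Prod>j\<in>J. epow (I j) (a j)) = (\<Prod>j\<in>J. ennreal (r j powr a j))"
        by (intro prod.cong refl) (use r a0 in \<open>simp add: epow_ennreal less_imp_le\<close>)
      then show ?thesis by (simp add: P_def prod_ennreal)
    qed
    have pt: "(\<Prod>j\<in>J. epow (f j x) (a j)) \<le> ennreal P * (\<Sum>j\<in>J. ennreal (a j / r j) * f j x)" for x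
    proof (cases "\<exists>j\<in>J. f j x = top")
      case True
      then obtain j where j: "j \<in> J" "f j x = top" by auto
      have "0 < a j / r j" using j r(2) a(1) by (intro divide_pos_pos) auto
      then have "ennreal (a j / r j) \<noteq> 0" by (simp add: ennreal_eq_0_iff not_le)
      then have "ennreal (a j / r j) * f j x = top" using j by (simp add: ennreal_mult_top)
      then have "(\<Sum>j\<in>J. ennreal (a j / r j) * f j x) = top" using J j by (simp add: sum.remove[of J j])
      then show ?thesis using P by (simp add: ennreal_mult_top)
    next
      case False
      define y where "y j = enn2real (f j x)" for j
      have y: "f j x = ennreal (y j)" "0 \<le> y j" if "j \<in> J" for j
        using False that by (simp_all add: y_def ennreal_enn2real_if)
      have "(\<Prod>j\<in>J. epow (f j x) (a j)) = (\<Prod>j\<in>J. ennreal (y j powr a j))"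
        by (intro prod.cong refl) (use y a0 in \<open>simp add: epow_ennreal\<close>)
      also have "\<dots> = ennreal (\<Prod>j\<in>J. y j powr a j)" by (simp add: prod_ennreal)
      also have "(\<Prod>j\<in>J. y j powr a j) = (\<Prod>j\<in>J. r j powr a j * (y j / r j) powr a j)"
        by (intro prod.cong refl, subst powr_mult[symmetric])
          (use r y in \<open>auto simp: less_imp_le dest: r(2)\<close>)
      also have "\<dots> = P * (\<Prod>j\<in>J. (y j / r j) powr a j)" by (simp add: P_def prod.distrib)
      also have "(\<Prod>j\<in>J. (y j / r j) powr a j) \<le> (\<Sum>j\<in>J. a j * (y j / r j))"
        by (rule weighted_AM_GM) (use J a r y in \<open>auto simp: less_imp_le\<close>)
      finally have "(\<Prod>j\<in>J. epow (f j x) (a j)) \<le> ennreal (P * (\<Sum>j\<in>J. a j * (y j / r j)))"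
        using P by (simp add: ennreal_leI)
      also have "\<dots> = ennreal P * ennreal (\<Sum>j\<in>J. a j * (y j / r j))"
        using P by (simp add: ennreal_mult')
      also have "ennreal (\<Sum>j\<in>J. a j * (y j / r j)) = (\<Sum>j\<in>J. ennreal (a j * (y j / r j)))"
        by (rule sum_ennreal[symmetric]) (use a r y in \<open>auto simp: less_imp_le\<close>)
      also have "\<dots> = (\<Sum>j\<in>J. ennreal (a j / r j) * f j x)"
        by (intro sum.cong refl) (use a r y in \<open>auto simp: less_imp_le ennreal_mult'[symmetric]\<close>)
      finally show ?thesis .
    qed
    have "(\<integral>\<^sup>+x. (\<Prod>j\<in>J. epow (f j x) (a j)) \<partial>M)
        \<le> (\<integral>\<^sup>+x. ennreal P * (\<Sum>j\<in>J. ennreal (a j / r j) * f j x) \<partial>M)"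
      by (intro nn_integral_mono pt)
    also have "\<dots> = ennreal P * (\<Sum>j\<in>J. ennreal (a j / r j) * I j)"
      using f by (simp add: nn_integral_cmult nn_integral_sum I_def)
    also have "(\<Sum>j\<in>J. ennreal (a j / r j) * I j) = (\<Sum>j\<in>J. ennreal (a j))"
    proof (intro sum.cong refl)
      fix j assume "j \<in> J"
      then show "ennreal (a j / r j) * I j = ennreal (a j)"
        using r[of j] a(1)[of j] by (simp add: ennreal_mult''[symmetric] less_imp_le)
    qed
    also have "\<dots> = ennreal (\<Sum>j\<in>J. a j)" by (rule sum_ennreal) (use a in \<open>auto intro: less_imp_le\<close>)
    finally have "(\<integral>\<^sup>+x. (\<Prod>j\<in>J. epow (f j x) (a j)) \<partial>M) \<le> ennreal P" by (simp add: a)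
    then show ?thesis using Pe unfolding I_def by simp
  qed
qed

lemma Hoelder_ennreal:
  assumes J: "finite J" and a: "\<And>j. j \<in> J \<Longrightarrow> 0 \<le> a j" "(\<Sum>j\<in>J. a j) = 1"
    and f: "\<And>j. j \<in> J \<Longrightarrow> f j \<in> borel_measurable M"
  shows "(\<integral>\<^sup>+x. (\<Prod>j\<in>J. epow (f j x) (a j)) \<partial>M) \<le> (\<Prod>j\<in>J. epow (\<integral>\<^sup>+x. f j x \<partial>M) (a j))"
proof -
  define K where "K = {j \<in> J. a j \<noteq> 0}"
  have K: "finite K" "K \<subseteq> J" using J by (auto simp: K_def)
  have eq: "(\<Prod>j\<in>J. epow (F j) (a j)) = (\<Prod>j\<in>K. epow (F j) (a j))" for F
    by (rule prod.mono_neutral_right) (use J in \<open>auto simp: K_def\<close>)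
  have "(\<Sum>j\<in>K. a j) = 1"
    using a(2) by (subst sum.mono_neutral_left[OF J]) (auto simp: K_def)
  then show ?thesis unfolding eq
    by (intro Hoelder_ennreal_pos_exponents) (use K a f in \<open>force simp: K_def\<close>)+
qed

lemma Hoelder_real:
  fixes f :: "'b \<Rightarrow> 'a \<Rightarrow> real"
  assumes J: "finite J" and a: "\<And>j. j \<in> J \<Longrightarrow> 0 < a j" "(\<Sum>j\<in>J. a j) = 1"
    and f: "\<And>j. j \<in> J \<Longrightarrow> integrable M (f j)" "\<And>j x. j \<in> J \<Longrightarrow> 0 \<le> f j x"
  shows "integrable M (\<lambda>x. \<Prod>j\<in>J. f j x powr a j)"
    and "(\<integral>x. (\<Prod>j\<in>J. f j x powr a j) \<partial>M) \<le> (\<Prod>j\<in>J. (\<integral>x. f j x \<partial>M) powr a j)"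
proof -
  have fm [measurable]: "j \<in> J \<Longrightarrow> f j \<in> borel_measurable M" for j using f by auto
  have I: "0 \<le> (\<integral>x. f j x \<partial>M)" if "j \<in> J" for j using f that by auto
  have e: "(\<Prod>j\<in>J. epow (ennreal (F j)) (a j)) = ennreal (\<Prod>j\<in>J. F j powr a j)"
    if "\<And>j. j \<in> J \<Longrightarrow> 0 \<le> F j" for F
  proof -
    have "(\<Prod>j\<in>J. epow (ennreal (F j)) (a j)) = (\<Prod>j\<in>J. ennreal (F j powr a j))"
    proof (intro prod.cong refl)
      fix j assume "j \<in> J"
      then show "epow (ennreal (F j)) (a j) = ennreal (F j powr a j)"
        using that[of j] a(1)[of j] by (simp add: epow_ennreal)
    qed
    then show ?thesis by (simp add: prod_ennreal)
  qed
  have "(\<integral>\<^sup>+x. ennreal (\<Prod>j\<in>J. f j x powr a j) \<partial>M) = (\<integral>\<^sup>+x. (\<Prod>j\<in>J. epow (ennreal (f j x)) (a j)) \<partial>M)"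
    using f by (subst e) auto
  also have "\<dots> \<le> (\<Prod>j\<in>J. epow (\<integral>\<^sup>+x. ennreal (f j x) \<partial>M) (a j))"
    by (rule Hoelder_ennreal_pos_exponents) (use J a fm in auto)
  also have "\<dots> = (\<Prod>j\<in>J. epow (ennreal (\<integral>x. f j x \<partial>M)) (a j))"
    using f by (intro prod.cong refl) (simp add: nn_integral_eq_integral)
  also have "\<dots> = ennreal (\<Prod>j\<in>J. (\<integral>x. f j x \<partial>M) powr a j)" using I by (rule e)
  finally have le: "(\<integral>\<^sup>+x. ennreal (\<Prod>j\<in>J. f j x powr a j) \<partial>M) \<le> ennreal (\<Prod>j\<in>J. (\<integral>x. f j x \<partial>M) powr a j)" .
  have nn: "0 \<le> (\<Prod>j\<in>J. f j x powr a j)" for x by (simp add: prod_nonneg)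
  show int: "integrable M (\<lambda>x. \<Prod>j\<in>J. f j x powr a j)"
  proof (rule integrableI_bounded)
    show "(\<lambda>x. \<Prod>j\<in>J. f j x powr a j) \<in> borel_measurable M" by measurable
    show "(\<integral>\<^sup>+x. ennreal (norm (\<Prod>j\<in>J. f j x powr a j)) \<partial>M) < \<infinity>"
      using le nn by (simp add: le_less_trans)
  qed
  show "(\<integral>x. (\<Prod>j\<in>J. f j x powr a j) \<partial>M) \<le> (\<Prod>j\<in>J. (\<integral>x. f j x \<partial>M) powr a j)"
    using le nn int by (simp add: nn_integral_eq_integral prod_nonneg)
qed


section \<open>Calculus of smooth functions and test functions\<close>

lemma partial_deriv_eq:
  assumes "(f has_derivative f') (at x)"
  shows "partial_deriv b f x = f' b"
  using frechet_derivative_at[OF assms] by (simp add: partial_deriv_def)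

lemma C_k_continuous: "C_k k f \<Longrightarrow> continuous_on UNIV f"
proof (cases k)
  case (Suc n)
  moreover assume "C_k k f"
  ultimately show ?thesis
    by (intro differentiable_imp_continuous_on) (auto simp: differentiable_on_def)
qed auto

lemma C_k_Suc_D: "C_k (Suc k) f \<Longrightarrow> C_k k f"
proof (induction k arbitrary: f)
  case 0
  then show ?case using C_k_continuous[OF 0] by simp
qed auto

lemma C_k_const: "C_k k (\<lambda>x. c)"
proof (induction k arbitrary: c)
  case (Suc k)
  have "partial_deriv b (\<lambda>x. c) = (\<lambda>x. 0)" for b :: 'a
    by (rule ext) (subst partial_deriv_eq[OF has_derivative_const], simp)
  then show ?case using Suc by simp
qed simp

lemma partial_deriv_add:
  assumes "f differentiable at x" "g differentiable at x"
  shows "partial_deriv b (\<lambda>x. f x + g x) x = partial_deriv b f x + partial_deriv b g x"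
  using has_derivative_add[OF frechet_derivative_works[THEN iffD1, OF assms(1)] frechet_derivative_works[THEN iffD1, OF assms(2)]]
  by (subst partial_deriv_eq) (auto simp: partial_deriv_def)

lemma partial_deriv_mult:
  assumes "f differentiable at x" "g differentiable at x"
  shows "partial_deriv b (\<lambda>x. f x * g x) x = f x * partial_deriv b g x + partial_deriv b f x * g x"
  using has_derivative_mult[OF frechet_derivative_works[THEN iffD1, OF assms(1)] frechet_derivative_works[THEN iffD1, OF assms(2)]]
  by (subst partial_deriv_eq) (auto simp: partial_deriv_def)

lemma C_k_add: "C_k k f \<Longrightarrow> C_k k g \<Longrightarrow> C_k k (\<lambda>x. f x + g x)"
proof (induction k arbitrary: f g)
  case (Suc k)
  then have "partial_deriv b (\<lambda>x. f x + g x) = (\<lambda>x. partial_deriv b f x + partial_deriv b g x)" for b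
    by (intro ext partial_deriv_add) auto
  with Suc show ?case by auto
qed (auto intro!: continuous_intros)

lemma C_k_mult: "C_k k f \<Longrightarrow> C_k k g \<Longrightarrow> C_k k (\<lambda>x. f x * g x)"
proof (induction k arbitrary: f g)
  case (Suc k)
  then have eq: "partial_deriv b (\<lambda>x. f x * g x) = (\<lambda>x. f x * partial_deriv b g x + partial_deriv b f x * g x)" for b
    by (intro ext partial_deriv_mult) auto
  show ?case
    using Suc.prems C_k_Suc_D[OF Suc.prems(1)] C_k_Suc_D[OF Suc.prems(2)]
    unfolding C_k.simps(2) eq by (auto intro!: C_k_add Suc.IH)
qed (auto intro!: continuous_intros)

lemma partial_deriv_compose:
  assumes "(h has_real_derivative h') (at (f x))" "f differentiable at x"
  shows "partial_deriv b (\<lambda>x. h (f x)) x = h' * partial_deriv b f x"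
proof -
  have "((\<lambda>x. h (f x)) has_derivative (\<lambda>v. h' * frechet_derivative f (at x) v)) (at x)"
    using has_derivative_compose[OF frechet_derivative_works[THEN iffD1, OF assms(2)] assms(1)[unfolded has_field_derivative_def]] by simp
  then show ?thesis by (subst partial_deriv_eq) (auto simp: partial_deriv_def)
qed

lemma C_k_real_derivative:
  fixes h :: "real \<Rightarrow> real"
  assumes "C_k (Suc k) h"
  shows "(h has_real_derivative partial_deriv 1 h x) (at x)"
proof -
  have d: "(h has_derivative frechet_derivative h (at x)) (at x)"
    using assms by (intro frechet_derivative_works[THEN iffD1]) auto
  have "frechet_derivative h (at x) v = partial_deriv 1 h x * v" for v
    using linear_scale[OF has_derivative_linear[OF d], of v 1] by (simp add: partial_deriv_def)
  then have "frechet_derivative h (at x) = (*) (partial_deriv 1 h x)" by auto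
  with d show ?thesis by (simp add: has_field_derivative_def)
qed

lemma C_k_of_real_derivative:
  fixes h :: "real \<Rightarrow> real"
  assumes "\<And>x. (h has_real_derivative h' x) (at x)" "C_k k h'"
  shows "C_k (Suc k) h"
proof -
  have "partial_deriv 1 h = h'"
    by (rule ext, subst partial_deriv_eq[OF assms(1)[unfolded has_field_derivative_def]]) simp
  moreover have "h differentiable at x" for x
    using assms(1)[of x] real_differentiable_def by blast
  ultimately show ?thesis using assms(2) by simp
qed

text \<open>
The chain rule expresses the partial derivatives of the composition by compositions and products of functions
that are one degree less smooth, so \<open>h\<close> is generalised in the induction.
\<close>
lemma C_k_compose:
  fixes h :: "real \<Rightarrow> real"
  assumes "C_k k h" "C_k k f"
  shows "C_k k (\<lambda>x. h (f x))"
  using assms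
proof (induction k arbitrary: h)
  case 0
  then show ?case using continuous_on_compose2[of UNIV h UNIV f] by auto
next
  case (Suc k)
  have hd: "(h has_real_derivative partial_deriv 1 h x) (at x)" for x
    by (rule C_k_real_derivative[OF Suc.prems(1)])
  have fd: "f differentiable at x" for x using Suc.prems(2) by simp
  have eq: "partial_deriv b (\<lambda>x. h (f x)) = (\<lambda>x. partial_deriv 1 h (f x) * partial_deriv b f x)" for b
    by (intro ext partial_deriv_compose hd fd)
  have "(\<lambda>x. h (f x)) differentiable at x" for x
    using differentiable_compose[of h f x UNIV] hd[of "f x"] fd[of x] real_differentiable_def by blast
  moreover have "C_k k (\<lambda>x. partial_deriv 1 h (f x))"
    by (rule Suc.IH) (use Suc.prems C_k_Suc_D[OF Suc.prems(2)] in \<open>auto\<close>)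
  ultimately show ?case using Suc.prems unfolding C_k.simps(2) eq by (auto intro!: C_k_mult)
qed

lemma C_k_sin_cos: "C_k k (sin :: real \<Rightarrow> real) \<and> C_k k (cos :: real \<Rightarrow> real)"
proof (induction k)
  case 0
  show ?case by (auto intro!: continuous_intros)
next
  case (Suc k)
  have "C_k (Suc k) (sin :: real \<Rightarrow> real)"
    using Suc by (intro C_k_of_real_derivative[where h' = cos]) (auto intro!: derivative_eq_intros)
  moreover have "C_k (Suc k) (cos :: real \<Rightarrow> real)"
  proof (rule C_k_of_real_derivative[where h' = "\<lambda>x. (-1) * sin x"])
    show "C_k k (\<lambda>x::real. (-1) * sin x)" using Suc by (intro C_k_mult C_k_const) auto
  qed (auto intro!: derivative_eq_intros)
  ultimately show ?case by simp
qed

lemma C_k_id: "C_k k (\<lambda>x::real. x)"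
proof (cases k)
  case (Suc n)
  then show ?thesis by (auto intro!: C_k_of_real_derivative[where h' = "\<lambda>_. 1"] C_k_const derivative_eq_intros simp del: C_k.simps)
qed (auto intro!: continuous_intros)

lemma C_k_power: "C_k k f \<Longrightarrow> C_k k (\<lambda>x. f x ^ m)"
  by (induction m) (auto intro: C_k_const C_k_mult)

lemma C_k_sum: "(\<And>i. i \<in> I \<Longrightarrow> C_k k (f i)) \<Longrightarrow> C_k k (\<lambda>x. \<Sum>i\<in>I. f i x)"
  by (induction I rule: infinite_finite_induct) (auto intro: C_k_const C_k_add)

lemma frechet_derivative_grad:
  assumes "f differentiable at x"
  shows "frechet_derivative f (at x) v = grad f x \<bullet> v"
proof -
  have lin: "linear (frechet_derivative f (at x))" by (rule linear_frechet_derivative[OF assms])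
  have "frechet_derivative f (at x) v = frechet_derivative f (at x) (\<Sum>b\<in>Basis. (v \<bullet> b) *\<^sub>R b)"
    by (simp add: euclidean_representation)
  also have "\<dots> = (\<Sum>b\<in>Basis. (v \<bullet> b) * partial_deriv b f x)"
    by (simp add: linear_sum[OF lin] linear_scale[OF lin] partial_deriv_def)
  also have "\<dots> = grad f x \<bullet> v"
    by (simp add: grad_def inner_sum_left inner_commute[of v] mult.commute)
  finally show ?thesis .
qed

lemma grad_compose:
  assumes "(h has_real_derivative h') (at (f x))" "f differentiable at x"
  shows "grad (\<lambda>x. h (f x)) x = h' *\<^sub>R grad f x"
  unfolding grad_def using partial_deriv_compose[OF assms] by (simp add: scaleR_sum_right)

lemma continuous_on_grad: "C_k 1 f \<Longrightarrow> continuous_on UNIV (grad f)"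
  unfolding grad_def by (auto intro!: continuous_intros)

lemma partial_deriv_locally_0:
  assumes "open S" "x \<in> S" "\<And>y. y \<in> S \<Longrightarrow> f y = 0"
  shows "partial_deriv b f x = 0"
proof -
  have "(f has_derivative (\<lambda>_. 0)) (at x)"
    by (rule has_derivative_transform_within_open[OF has_derivative_const assms(1,2)]) (use assms in auto)
  then show ?thesis by (subst partial_deriv_eq) auto
qed

lemma partial_deriv_outside_support:
  assumes "x \<notin> closure {x. f x \<noteq> 0}"
  shows "partial_deriv b f x = 0"
proof (rule partial_deriv_locally_0[of "- closure {x. f x \<noteq> 0}"])
  show "f y = 0" if "y \<in> - closure {x. f x \<noteq> 0}" for y
    using that subsetD[OF closure_subset, of y "{x. f x \<noteq> 0}"] by auto
qed (use assms in auto)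

lemma grad_outside_support: "x \<notin> closure {x. f x \<noteq> 0} \<Longrightarrow> grad f x = 0"
  by (simp add: grad_def partial_deriv_outside_support)

lemma test_functions_C_k: "\<phi> \<in> test_functions \<Omega> \<Longrightarrow> C_k k \<phi>"
  by (auto simp: test_functions_def)

lemma test_functions_subsupport:
  assumes "\<phi> \<in> test_functions \<Omega>" "\<And>k. C_k k \<eta>" "{x. \<eta> x \<noteq> 0} \<subseteq> closure {x. \<phi> x \<noteq> 0}"
  shows "\<eta> \<in> test_functions \<Omega>"
proof -
  have "closure {x. \<eta> x \<noteq> 0} \<subseteq> closure {x. \<phi> x \<noteq> 0}"
    using closure_mono[OF assms(3)] by simp
  moreover have "compact (closure {x. \<phi> x \<noteq> 0})" "closure {x. \<phi> x \<noteq> 0} \<subseteq> \<Omega>"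
    using assms(1) by (auto simp: test_functions_def)
  ultimately have "compact (closure {x. \<eta> x \<noteq> 0})" "closure {x. \<eta> x \<noteq> 0} \<subseteq> \<Omega>"
    by (auto simp: compact_eq_bounded_closed intro: bounded_subset)
  then show ?thesis using assms(2) by (simp add: test_functions_def)
qed

lemma test_functions_partial_deriv:
  assumes "\<phi> \<in> test_functions \<Omega>" "b \<in> Basis"
  shows "partial_deriv b \<phi> \<in> test_functions \<Omega>"
proof (rule test_functions_subsupport[OF assms(1)])
  show "C_k k (partial_deriv b \<phi>)" for k
    using test_functions_C_k[OF assms(1), of "Suc k"] assms(2) by simp
qed (use partial_deriv_outside_support[of _ \<phi> b] in auto)

lemma test_functions_compose:
  assumes "\<phi> \<in> test_functions \<Omega>" "\<And>k. C_k k h" "h 0 = 0"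
  shows "(\<lambda>x. h (\<phi> x)) \<in> test_functions \<Omega>"
proof (rule test_functions_subsupport[OF assms(1)])
  show "C_k k (\<lambda>x. h (\<phi> x))" for k
    by (rule C_k_compose[OF assms(2) test_functions_C_k[OF assms(1)]])
  have "{x. h (\<phi> x) \<noteq> 0} \<subseteq> {x. \<phi> x \<noteq> 0}" using assms(3) by auto
  then show "{x. h (\<phi> x) \<noteq> 0} \<subseteq> closure {x. \<phi> x \<noteq> 0}" using closure_subset by (rule subset_trans)
qed


section \<open>The Gagliardo--Nirenberg--Sobolev inequality\<close>

text \<open>
The factor in front of the product is there to make an induction on the set of coordinates possible while
\<open>p\<close> is kept fixed. Integrate in the new coordinate \<open>i\<close> first. The line integral in direction \<open>i\<close> is then a
constant, and the exponents of the other factors add up to 1, so Hoelder's inequality replaces \<open>f\<close>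
everywhere by its integral \<open>g\<close> over coordinate \<open>i\<close>. The constant factor is itself a power of \<open>g\<close> and raises the
exponent of \<open>g\<close> to the one in the induction hypothesis. The case of interest is
\<open>p = 1 / (card s - 1)\<close>, in which the factor in front is 1.
\<close>
lemma line_integrals_product_bound:
  fixes f :: "('i \<Rightarrow> real) \<Rightarrow> ennreal"
  assumes "finite s" "0 \<le> p" "(real (card s) - 1) * p \<le> 1"
    and "f \<in> borel_measurable (Pi\<^sub>M s (\<lambda>_. lborel))"
  shows "(\<integral>\<^sup>+x. epow (f x) (1 - (real (card s) - 1) * p) *
             (\<Prod>j\<in>s. epow (\<integral>\<^sup>+t. f (x(j := t)) \<partial>lborel) p) \<partial>Pi\<^sub>M s (\<lambda>_. lborel))
         \<le> epow (\<integral>\<^sup>+x. f x \<partial>Pi\<^sub>M s (\<lambda>_. lborel)) (1 + p)"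
  using assms
proof (induction s arbitrary: f rule: finite_induct)
  case empty
  interpret product_sigma_finite "\<lambda>_::'i. lborel :: real measure" by standard
  show ?case by (simp add: PiM_empty nn_integral_count_space_finite)
next
  case (insert i s)
  interpret product_sigma_finite "\<lambda>_::'i. lborel :: real measure" by standard
  note fm [measurable] = insert.prems(3)
  have upd [measurable]: "(\<lambda>z. (fst z)(j := snd z)) \<in> Pi\<^sub>M I (\<lambda>_. lborel) \<Otimes>\<^sub>M lborel \<rightarrow>\<^sub>M Pi\<^sub>M (insert j I) (\<lambda>_. lborel :: real measure)"
    for j :: 'i and I using measurable_add_dim[of j I "\<lambda>_. lborel :: real measure"] by (simp add: case_prod_beta')
  have slice [measurable]: "(\<lambda>x. \<integral>\<^sup>+t. h (x(j := t)) \<partial>lborel) \<in> borel_measurable (Pi\<^sub>M I (\<lambda>_. lborel))"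
    if [measurable]: "h \<in> borel_measurable (Pi\<^sub>M (insert j I) (\<lambda>_. lborel))" for h :: "('i \<Rightarrow> real) \<Rightarrow> ennreal" and j I
  proof -
    have "(\<lambda>z. h ((fst z)(j := snd z))) \<in> borel_measurable (Pi\<^sub>M I (\<lambda>_. lborel) \<Otimes>\<^sub>M lborel)"
      using measurable_compose[OF upd that] .
    then show ?thesis using lborel.borel_measurable_nn_integral_fst by fastforce
  qed
  define k where "k = real (card s)"
  have kp: "k * p \<le> 1" using insert by (simp add: k_def)
  define g where "g x = (\<integral>\<^sup>+t. f (x(i := t)) \<partial>lborel)" for x
  have g [measurable]: "g \<in> borel_measurable (Pi\<^sub>M s (\<lambda>_. lborel))"
    unfolding g_def by measurable
  have gj: "(\<integral>\<^sup>+y. \<integral>\<^sup>+t. f (x(i := y, j := t)) \<partial>lborel \<partial>lborel) = (\<integral>\<^sup>+t. g (x(j := t)) \<partial>lborel)"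
    if x: "x \<in> space (Pi\<^sub>M s (\<lambda>_. lborel))" and j: "j \<in> s" for x j
  proof -
    have ji: "j \<noteq> i" using j insert by auto
    have "(\<lambda>z. (x(j := fst z))(i := snd z)) \<in> (lborel :: real measure) \<Otimes>\<^sub>M lborel \<rightarrow>\<^sub>M Pi\<^sub>M (insert i s) (\<lambda>_. lborel)"
      by (rule measurable_PiM_single') (use x j in \<open>auto simp: space_PiM PiE_iff extensional_def\<close>)
    from measurable_compose[OF this fm]
    have m: "(\<lambda>(t, y). f (x(j := t, i := y))) \<in> borel_measurable (lborel \<Otimes>\<^sub>M lborel)" by (simp add: case_prod_beta' fun_upd_def)
    have "(\<integral>\<^sup>+y. \<integral>\<^sup>+t. f (x(i := y, j := t)) \<partial>lborel \<partial>lborel) = (\<integral>\<^sup>+y. \<integral>\<^sup>+t. f (x(j := t, i := y)) \<partial>lborel \<partial>lborel)"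
      using ji by (simp add: fun_upd_twist)
    also have "\<dots> = (\<integral>\<^sup>+t. \<integral>\<^sup>+y. f (x(j := t, i := y)) \<partial>lborel \<partial>lborel)"
      by (rule lborel_pair.Fubini'[OF m])
    finally show ?thesis by (simp add: g_def)
  qed
  define h where "h x j y = (if j = i then f (x(i := y)) else \<integral>\<^sup>+t. f (x(i := y, j := t)) \<partial>lborel)" for x j y
  define a where "a j = (if j = i then 1 - k * p else p)" for j
  have inner: "(\<integral>\<^sup>+y. epow (f (x(i := y))) (1 - k * p) *
         (\<Prod>j\<in>insert i s. epow (\<integral>\<^sup>+t. f (x(i := y, j := t)) \<partial>lborel) p) \<partial>lborel)
      \<le> epow (g x) (1 - (k - 1) * p) * (\<Prod>j\<in>s. epow (\<integral>\<^sup>+t. g (x(j := t)) \<partial>lborel) p)"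
    if x: "x \<in> space (Pi\<^sub>M s (\<lambda>_. lborel))" for x
  proof -
    have ui: "(\<lambda>y. x(i := y)) \<in> lborel \<rightarrow>\<^sub>M Pi\<^sub>M (insert i s) (\<lambda>_. lborel)"
      by (rule measurable_component_update) (use x insert in auto)
    have hm: "h x j \<in> borel_measurable lborel" if "j \<in> insert i s" for j
    proof (cases "j = i")
      case True
      then show ?thesis using measurable_compose[OF ui fm] by (simp add: h_def[abs_def] fun_upd_def)
    next
      case False
      with that have ins: "insert j (insert i s) = insert i s" by auto
      have "(\<lambda>z. \<integral>\<^sup>+t. f (z(j := t)) \<partial>lborel) \<in> borel_measurable (Pi\<^sub>M (insert i s) (\<lambda>_. lborel))"
        by (rule slice) (simp add: ins)
      from measurable_compose[OF ui this] show ?thesis using False by (simp add: h_def[abs_def])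
    qed
    have suma: "(\<Sum>j\<in>insert i s. a j) = 1"
    proof -
      have "(\<Sum>j\<in>s. a j) = (\<Sum>j\<in>s. p)" using insert by (intro sum.cong) (auto simp: a_def)
      then show ?thesis using insert by (simp add: a_def k_def)
    qed
    have "(\<integral>\<^sup>+y. epow (f (x(i := y))) (1 - k * p) *
         (\<Prod>j\<in>insert i s. epow (\<integral>\<^sup>+t. f (x(i := y, j := t)) \<partial>lborel) p) \<partial>lborel)
       = (\<integral>\<^sup>+y. epow (g x) p * (\<Prod>j\<in>insert i s. epow (h x j y) (a j)) \<partial>lborel)"
    proof (intro nn_integral_cong)
      fix y :: real
      have "(\<Prod>j\<in>s. epow (\<integral>\<^sup>+t. f (x(i := y, j := t)) \<partial>lborel) p) = (\<Prod>j\<in>s. epow (h x j y) (a j))"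
        using insert by (intro prod.cong) (auto simp: h_def a_def)
      then show "epow (f (x(i := y))) (1 - k * p) *
         (\<Prod>j\<in>insert i s. epow (\<integral>\<^sup>+t. f (x(i := y, j := t)) \<partial>lborel) p)
       = epow (g x) p * (\<Prod>j\<in>insert i s. epow (h x j y) (a j))"
        using insert by (simp add: h_def a_def g_def mult_ac)
    qed
    also have "\<dots> = epow (g x) p * (\<integral>\<^sup>+y. (\<Prod>j\<in>insert i s. epow (h x j y) (a j)) \<partial>lborel)"
      using hm by (intro nn_integral_cmult borel_measurable_prod_ennreal measurable_epow) auto
    also have "\<dots> \<le> epow (g x) p * (\<Prod>j\<in>insert i s. epow (\<integral>\<^sup>+y. h x j y \<partial>lborel) (a j))"
      by (intro mult_left_mono Hoelder_ennreal) (use insert hm suma kp in \<open>auto simp: a_def\<close>)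
    also have "(\<Prod>j\<in>insert i s. epow (\<integral>\<^sup>+y. h x j y \<partial>lborel) (a j))
        = epow (g x) (1 - k * p) * (\<Prod>j\<in>s. epow (\<integral>\<^sup>+t. g (x(j := t)) \<partial>lborel) p)"
    proof -
      have "(\<Prod>j\<in>s. epow (\<integral>\<^sup>+y. h x j y \<partial>lborel) (a j)) = (\<Prod>j\<in>s. epow (\<integral>\<^sup>+t. g (x(j := t)) \<partial>lborel) p)"
        using insert by (intro prod.cong refl) (auto simp: h_def a_def gj[OF x])
      then show ?thesis using insert by (simp add: h_def a_def g_def)
    qed
    also have "epow (g x) p * (epow (g x) (1 - k * p) * (\<Prod>j\<in>s. epow (\<integral>\<^sup>+t. g (x(j := t)) \<partial>lborel) p))
        = epow (g x) (1 - (k - 1) * p) * (\<Prod>j\<in>s. epow (\<integral>\<^sup>+t. g (x(j := t)) \<partial>lborel) p)"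
    proof -
      have e: "1 - (k - 1) * p = p + (1 - k * p)" by (simp add: algebra_simps)
      have "epow (g x) (p + (1 - k * p)) = epow (g x) p * epow (g x) (1 - k * p)"
        using kp insert.prems by (intro epow_add) auto
      then show ?thesis unfolding e by (simp add: mult.assoc)
    qed
    finally show ?thesis .
  qed
  have ce: "real (card (insert i s)) - 1 = k" using insert by (simp add: k_def)
  have Fm: "(\<lambda>x. epow (f x) (1 - k * p) *
             (\<Prod>j\<in>insert i s. epow (\<integral>\<^sup>+t. f (x(j := t)) \<partial>lborel) p)) \<in> borel_measurable (Pi\<^sub>M (insert i s) (\<lambda>_. lborel))"
  proof (intro borel_measurable_times_ennreal measurable_epow borel_measurable_prod_ennreal fm slice)
    fix j assume "j \<in> insert i s"
    then have "insert j (insert i s) = insert i s" by auto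
    then show "f \<in> borel_measurable (Pi\<^sub>M (insert j (insert i s)) (\<lambda>_. lborel))" by simp
  qed
  have "(\<integral>\<^sup>+x. epow (f x) (1 - k * p) *
             (\<Prod>j\<in>insert i s. epow (\<integral>\<^sup>+t. f (x(j := t)) \<partial>lborel) p) \<partial>Pi\<^sub>M (insert i s) (\<lambda>_. lborel))
     = (\<integral>\<^sup>+x. (\<integral>\<^sup>+y. epow (f (x(i := y))) (1 - k * p) *
         (\<Prod>j\<in>insert i s. epow (\<integral>\<^sup>+t. f (x(i := y, j := t)) \<partial>lborel) p) \<partial>lborel) \<partial>Pi\<^sub>M s (\<lambda>_. lborel))"
    by (rule product_nn_integral_insert) (use insert Fm in auto)
  also have "\<dots> \<le> (\<integral>\<^sup>+x. epow (g x) (1 - (k - 1) * p) * (\<Prod>j\<in>s. epow (\<integral>\<^sup>+t. g (x(j := t)) \<partial>lborel) p) \<partial>Pi\<^sub>M s (\<lambda>_. lborel))"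
    by (intro nn_integral_mono inner)
  also have "\<dots> \<le> epow (\<integral>\<^sup>+x. g x \<partial>Pi\<^sub>M s (\<lambda>_. lborel)) (1 + p)"
    unfolding k_def
  proof (rule insert.IH)
    show "(real (card s) - 1) * p \<le> 1" using kp insert.prems(1) by (simp add: k_def algebra_simps)
  qed (use insert in auto)
  also have "(\<integral>\<^sup>+x. g x \<partial>Pi\<^sub>M s (\<lambda>_. lborel)) = (\<integral>\<^sup>+x. f x \<partial>Pi\<^sub>M (insert i s) (\<lambda>_. lborel))"
    unfolding g_def by (rule product_nn_integral_insert[symmetric]) (use insert in auto)
  finally show ?case unfolding ce .
qed

text \<open>
The \<open>DIM('a)\<close>-fold product of the line bounds, each raised to the power \<open>1 / (m - 1)\<close>, bounds the integrand on
the left; Lebesgue measure is the image of the product measure over \<open>Basis\<close>, so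
\<open>line_integrals_product_bound\<close> applies. In the application \<open>F\<close> dominates the gradient of \<open>v\<close>.
\<close>
lemma gagliardo_nirenberg_lines:
  fixes v :: "'a::euclidean_space \<Rightarrow> real" and F :: "'a \<Rightarrow> ennreal"
  assumes n: "DIM('a) \<ge> 2" and v: "\<And>x. 0 \<le> v x"
    and F [measurable]: "F \<in> borel_measurable borel"
    and vm [measurable]: "v \<in> borel_measurable borel"
    and lines: "\<And>x b. b \<in> Basis \<Longrightarrow> ennreal (v x) \<le> (\<integral>\<^sup>+t. F (x + t *\<^sub>R b) \<partial>lborel)"
  defines "m \<equiv> real DIM('a)"
  shows "(\<integral>\<^sup>+x. ennreal (v x powr (m / (m - 1))) \<partial>lborel) \<le> epow (\<integral>\<^sup>+x. F x \<partial>lborel) (m / (m - 1))"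
proof -
  define e :: "('a \<Rightarrow> real) \<Rightarrow> 'a" where "e x = (\<Sum>b\<in>Basis. x b *\<^sub>R b)" for x
  define P where "P = Pi\<^sub>M (Basis :: 'a set) (\<lambda>_. lborel :: real measure)"
  have em [measurable]: "e \<in> P \<rightarrow>\<^sub>M borel" unfolding e_def P_def by measurable
  have trans: "(\<integral>\<^sup>+x. g x \<partial>lborel) = (\<integral>\<^sup>+x. g (e x) \<partial>P)" if [measurable]: "g \<in> borel_measurable borel" for g :: "'a \<Rightarrow> ennreal"
    by (subst lborel_eq) (simp add: nn_integral_distr e_def P_def)
  define p where "p = 1 / (m - 1)"
  have m: "m > 1" using n by (simp add: m_def)
  have p: "0 < p" "(m - 1) * p = 1" "m * p = m / (m - 1)" "1 + p = m / (m - 1)"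
    using m by (auto simp: p_def field_simps)
  have upd: "e (x(b := t)) = e x + (t - x b) *\<^sub>R b" if "b \<in> Basis" for x b t
  proof -
    have "(\<Sum>c\<in>Basis. (x(b := t)) c *\<^sub>R c) = (\<Sum>c\<in>Basis. x c *\<^sub>R c + (if c = b then (t - x b) *\<^sub>R b else 0))"
      by (intro sum.cong) (auto simp: algebra_simps)
    then show ?thesis using that by (simp add: e_def sum.distrib)
  qed
  have line: "ennreal (v (e x)) \<le> (\<integral>\<^sup>+t. F (e (x(b := t))) \<partial>lborel)" if b: "b \<in> Basis" for x b
  proof -
    have "(\<integral>\<^sup>+t. F (e x + t *\<^sub>R b) \<partial>lborel) = (\<integral>\<^sup>+t. F (e x + (- x b + 1 * t) *\<^sub>R b) \<partial>lborel)"
      by (subst nn_integral_real_affine[where c = 1 and t = "- x b"]) auto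
    also have "\<dots> = (\<integral>\<^sup>+t. F (e (x(b := t))) \<partial>lborel)"
      using b by (simp add: upd)
    finally show ?thesis using lines[OF b, of "e x"] by simp
  qed
  have pt: "ennreal (v (e x) powr (m / (m - 1))) \<le> (\<Prod>b\<in>Basis. epow (\<integral>\<^sup>+t. F (e (x(b := t))) \<partial>lborel) p)" for x
  proof -
    have "v (e x) powr (m / (m - 1)) = (\<Prod>b\<in>(Basis :: 'a set). v (e x) powr p)"
      using p(3) v[of "e x"] by (cases "v (e x) = 0") (auto simp: powr_power m_def mult.commute)
    then have "ennreal (v (e x) powr (m / (m - 1))) = (\<Prod>b\<in>(Basis :: 'a set). ennreal (v (e x) powr p))"
      by (simp only: prod_ennreal powr_ge_zero)
    also have "\<dots> = (\<Prod>b\<in>(Basis :: 'a set). epow (ennreal (v (e x))) p)"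
      using p v by (simp add: epow_ennreal)
    also have "\<dots> \<le> (\<Prod>b\<in>Basis. epow (\<integral>\<^sup>+t. F (e (x(b := t))) \<partial>lborel) p)"
      using p by (intro prod_mono_ennreal epow_mono line) auto
    finally show ?thesis .
  qed
  have "(\<integral>\<^sup>+x. ennreal (v x powr (m / (m - 1))) \<partial>lborel) = (\<integral>\<^sup>+x. ennreal (v (e x) powr (m / (m - 1))) \<partial>P)"
    by (rule trans) measurable
  also have "\<dots> \<le> (\<integral>\<^sup>+x. epow (F (e x)) (1 - (m - 1) * p) * (\<Prod>b\<in>Basis. epow (\<integral>\<^sup>+t. F (e (x(b := t))) \<partial>lborel) p) \<partial>P)"
    using pt p by (intro nn_integral_mono) simp
  also have "\<dots> \<le> epow (\<integral>\<^sup>+x. F (e x) \<partial>P) (1 + p)"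
    unfolding P_def m_def
  proof (rule line_integrals_product_bound)
    show "(\<lambda>x. F (e x)) \<in> borel_measurable (Pi\<^sub>M Basis (\<lambda>_. lborel))"
      unfolding P_def[symmetric] by measurable
  qed (use p in \<open>auto simp: m_def\<close>)
  also have "\<dots> = epow (\<integral>\<^sup>+x. F x \<partial>lborel) (m / (m - 1))"
    using p by (simp add: trans)
  finally show ?thesis .
qed

lemma FTC_ennreal_bound:
  fixes h :: "real \<Rightarrow> real"
  assumes "a \<le> t" "h a = 0" and d: "\<And>s. (h has_real_derivative h' s) (at s)"
    and c: "continuous_on UNIV h'"
  shows "ennreal (h t) \<le> (\<integral>\<^sup>+s. ennreal \<bar>h' s\<bar> \<partial>lborel)"
proof -
  have hb: "has_bochner_integral lborel (\<lambda>s. h' s * indicator {a..t} s) (h t - h a)"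
    by (rule has_bochner_integral_FTC_Icc_real)
      (use assms in \<open>auto simp: continuous_on_eq_continuous_at intro: has_field_derivative_at_within\<close>)
  then have "ennreal (norm (h t)) \<le> (\<integral>\<^sup>+s. norm (h' s * indicator {a..t} s) \<partial>lborel)"
    using integral_norm_bound_ennreal[of lborel "\<lambda>s. h' s * indicator {a..t} s"] assms(2)
    by (simp add: has_bochner_integral_iff)
  also have "\<dots> \<le> (\<integral>\<^sup>+s. ennreal \<bar>h' s\<bar> \<partial>lborel)"
    by (intro nn_integral_mono ennreal_leI) (auto simp: indicator_def)
  finally have "ennreal (norm (h t)) \<le> (\<integral>\<^sup>+s. ennreal \<bar>h' s\<bar> \<partial>lborel)" .
  moreover have "ennreal (h t) \<le> ennreal (norm (h t))" by (intro ennreal_leI) simp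
  ultimately show ?thesis by (rule order_trans[rotated])
qed

text \<open>
At \<open>s = 0\<close> the difference quotient is of order \<open>|y|\<^bsup>\<gamma>-1\<^esup>\<close>, hence \<open>\<gamma> > 1\<close>.
\<close>
lemma abs_powr_has_derivative:
  fixes \<gamma> :: real
  assumes "\<gamma> > 1"
  shows "((\<lambda>s. \<bar>s\<bar> powr \<gamma>) has_real_derivative \<gamma> * (s * \<bar>s\<bar> powr (\<gamma> - 2))) (at s)"
proof -
  consider "s > 0" | "s < 0" | "s = 0" by linarith
  then show ?thesis
  proof cases
    case 1
    have "s powr (\<gamma> - 1) = s * s powr (\<gamma> - 2)" using 1 by (simp add: powr_diff power2_eq_square field_simps)
    moreover have "((\<lambda>s. s powr \<gamma>) has_real_derivative \<gamma> * s powr (\<gamma> - 1)) (at s)"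
      using 1 by (rule has_real_derivative_powr)
    ultimately have "((\<lambda>s. s powr \<gamma>) has_real_derivative \<gamma> * (s * \<bar>s\<bar> powr (\<gamma> - 2))) (at s)" using 1 by simp
    then show ?thesis
      by (rule has_field_derivative_transform_within_open[where S = "{0<..}"]) (use 1 in auto)
  next
    case 2
    have "(-s) powr (\<gamma> - 1) = (-s) * (-s) powr (\<gamma> - 2)" using 2 by (simp add: powr_diff power2_eq_square field_simps)
    moreover have "((\<lambda>s. (-s) powr \<gamma>) has_real_derivative (\<gamma> * (-s) powr (\<gamma> - 1)) * (-1)) (at s)"
      by (rule DERIV_chain'[of uminus]) (use 2 in \<open>auto intro!: derivative_eq_intros has_real_derivative_powr\<close>)
    ultimately have "((\<lambda>s. (-s) powr \<gamma>) has_real_derivative \<gamma> * (s * \<bar>s\<bar> powr (\<gamma> - 2))) (at s)" using 2 by simp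
    then show ?thesis
      by (rule has_field_derivative_transform_within_open[where S = "{..<0}"]) (use 2 in auto)
  next
    case 3
    have "((\<lambda>y. \<bar>y\<bar> powr (\<gamma> - 1)) \<longlongrightarrow> 0) (at 0)"
      using assms by (intro tendsto_eq_intros tendsto_powr'[where b = "\<gamma> - 1", THEN tendsto_eq_rhs]) (auto intro!: tendsto_eq_intros)
    then have "((\<lambda>y. (\<bar>y\<bar> powr \<gamma> - \<bar>0\<bar> powr \<gamma>) / (y - 0)) \<longlongrightarrow> 0) (at (0::real))"
    proof (rule Lim_null_comparison[rotated], intro always_eventually allI)
      fix y :: real
      show "norm ((\<bar>y\<bar> powr \<gamma> - \<bar>0\<bar> powr \<gamma>) / (y - 0)) \<le> \<bar>y\<bar> powr (\<gamma> - 1)"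
        by (cases "y = 0") (auto simp: powr_diff)
    qed
    then show ?thesis using 3 by (simp add: has_field_derivative_iff)
  qed
qed

lemma integrable_continuous_compact_support:
  fixes g :: "'a::euclidean_space \<Rightarrow> 'b::{banach, second_countable_topology}"
  assumes "continuous_on UNIV g" "compact K" "\<And>x. x \<notin> K \<Longrightarrow> g x = 0"
  shows "integrable lborel g"
proof -
  have "integrable lborel (\<lambda>x. indicator K x *\<^sub>R g x)"
    by (rule borel_integrable_compact[OF assms(2)]) (use assms(1) continuous_on_subset in blast)
  moreover have "(\<lambda>x. indicator K x *\<^sub>R g x) = g" using assms(3) by (auto simp: indicator_def)
  ultimately show ?thesis by simp
qed

lemma continuous_on_abs_powr:
  fixes f :: "'a::topological_space \<Rightarrow> real"
  assumes "continuous_on S f" "a > 0"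
  shows "continuous_on S (\<lambda>x. \<bar>f x\<bar> powr a)"
  using assms by (intro continuous_on_powr' continuous_intros) auto

text \<open>
Apply \<open>gagliardo_nirenberg_lines\<close> to \<open>v = |\<phi>|\<^sup>\<gamma>\<close> with \<open>\<gamma> = 2(m - 1)/(m - 2)\<close>. This \<open>\<gamma>\<close> makes the
exponent \<open>\<gamma> m/(m - 1)\<close> on the left equal to \<open>q\<close>, and also \<open>2(\<gamma> - 1) = q\<close>, so that the Cauchy--Schwarz
inequality applied to \<open>|\<nabla>v| = \<gamma> |\<phi>|\<^bsup>\<gamma>-1\<^esup> |\<nabla>\<phi>|\<close> produces the same integral
of \<open>|\<phi>|\<^sup>q\<close>, with a smaller exponent, and it can be divided out.
\<close>
lemma sobolev_inequality:
  fixes \<phi> :: "'a::euclidean_space \<Rightarrow> real"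
  assumes n: "DIM('a) > 2" and C1: "C_k 1 \<phi>" and K: "compact (closure {x. \<phi> x \<noteq> 0})"
  defines "m \<equiv> real DIM('a)" and "q \<equiv> crit_exp DIM('a)"
  shows "(\<integral>x. \<bar>\<phi> x\<bar> powr q \<partial>lborel) powr (2 / q)
          \<le> (2 * (m - 1) / (m - 2))\<^sup>2 * (\<integral>x. (norm (grad \<phi> x))\<^sup>2 \<partial>lborel)"
proof -
  define K where "K = closure {x. \<phi> x \<noteq> 0}"
  have m: "m > 2" using n by (simp add: m_def)
  have q: "q = 2 * m / (m - 2)" "q > 0" using m by (simp_all add: q_def crit_exp_def m_def)
  define \<gamma> where "\<gamma> = 2 * (m - 1) / (m - 2)"
  have \<gamma>: "\<gamma> > 2" "\<gamma> - 1 = q / 2" "\<gamma> * (m / (m - 1)) = q" "2 / q = (m - 2) / m"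
  proof -
    show "\<gamma> > 2" "\<gamma> - 1 = q / 2" "2 / q = (m - 2) / m" using m by (auto simp: \<gamma>_def q field_simps)
    have "2 * d / e * (m / d) = 2 * m / e" if "d \<noteq> 0" for d e using that by simp
    from this[of "m - 1"] show "\<gamma> * (m / (m - 1)) = q" using m by (simp only: \<gamma>_def q)
  qed
  have c\<phi> [continuous_intros]: "continuous_on UNIV \<phi>" by (rule C_k_continuous[OF C1])
  have cg: "continuous_on UNIV (grad \<phi>)" by (rule continuous_on_grad[OF C1])
  have out: "\<phi> x = 0" "grad \<phi> x = 0" if "x \<notin> K" for x
  proof -
    show "\<phi> x = 0" using that subsetD[OF closure_subset, of x "{x. \<phi> x \<noteq> 0}"] by (auto simp: K_def)
    show "grad \<phi> x = 0" using that grad_outside_support by (auto simp: K_def)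
  qed
  have comp: "compact K" using K by (simp add: K_def)
  define F where "F x = \<bar>\<phi> x\<bar> powr (q / 2) * norm (grad \<phi> x)" for x
  have cF: "continuous_on UNIV F" unfolding F_def
    using q(2) by (intro continuous_on_mult continuous_on_abs_powr continuous_on_norm c\<phi> cg) auto
  have iq: "integrable lborel (\<lambda>x. \<bar>\<phi> x\<bar> powr q)"
    by (rule integrable_continuous_compact_support[OF _ comp])
      (use q(2) out in \<open>auto intro!: continuous_on_abs_powr c\<phi>\<close>)
  have ig: "integrable lborel (\<lambda>x. (norm (grad \<phi> x))\<^sup>2)"
    by (rule integrable_continuous_compact_support[OF _ comp])
      (use out cg in \<open>auto intro!: continuous_intros\<close>)
  define X where "X = (\<integral>x. \<bar>\<phi> x\<bar> powr q \<partial>lborel)"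
  define G where "G = (\<integral>x. (norm (grad \<phi> x))\<^sup>2 \<partial>lborel)"
  have X0: "0 \<le> X" and G0: "0 \<le> G" by (auto simp: X_def G_def)
  have F_eq: "F x = (\<Prod>j\<in>{0, 1::nat}. (if j = 0 then \<bar>\<phi> x\<bar> powr q else (norm (grad \<phi> x))\<^sup>2) powr (1/2))" for x
  proof -
    have "\<bar>\<phi> x\<bar> powr (q / 2) = (\<bar>\<phi> x\<bar> powr q) powr (1/2)" by (simp add: powr_powr)
    moreover have "norm (grad \<phi> x) = ((norm (grad \<phi> x))\<^sup>2) powr (1/2)" by (simp add: powr_half_sqrt)
    ultimately have "F x = (\<bar>\<phi> x\<bar> powr q) powr (1/2) * ((norm (grad \<phi> x))\<^sup>2) powr (1/2)"
      unfolding F_def by presburger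
    then show ?thesis by simp
  qed
  have iF: "integrable lborel F" and FX: "(\<integral>x. F x \<partial>lborel) \<le> X powr (1/2) * G powr (1/2)"
  proof -
    note H = Hoelder_real[of "{0, 1::nat}" "\<lambda>_. 1/2" lborel "\<lambda>j x. if j = 0 then \<bar>\<phi> x\<bar> powr q else (norm (grad \<phi> x))\<^sup>2"]
    show "integrable lborel F" unfolding F_eq by (rule H(1)) (use iq ig in auto)
    have "(\<integral>x. F x \<partial>lborel) \<le> (\<Prod>j\<in>{0, 1::nat}. (\<integral>x. (if j = 0 then \<bar>\<phi> x\<bar> powr q else (norm (grad \<phi> x))\<^sup>2) \<partial>lborel) powr (1/2))"
      unfolding F_eq by (rule H(2)) (use iq ig in auto)
    then show "(\<integral>x. F x \<partial>lborel) \<le> X powr (1/2) * G powr (1/2)" by (simp add: X_def G_def)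
  qed
  have lines: "ennreal (\<bar>\<phi> x\<bar> powr \<gamma>) \<le> (\<integral>\<^sup>+t. ennreal (\<gamma> * F (x + t *\<^sub>R b)) \<partial>lborel)"
    if b: "b \<in> Basis" for x b
  proof -
    define h where "h t = \<bar>\<phi> (x + t *\<^sub>R b)\<bar> powr \<gamma>" for t
    define h' where "h' t = \<gamma> * (\<phi> (x + t *\<^sub>R b) * \<bar>\<phi> (x + t *\<^sub>R b)\<bar> powr (\<gamma> - 2)) * (grad \<phi> (x + t *\<^sub>R b) \<bullet> b)" for t
    obtain R where R: "\<And>y. y \<in> K \<Longrightarrow> norm y \<le> R"
      using comp by (meson compact_imp_bounded bounded_iff)
    \<comment> \<open>A parameter at which the line through \<open>x\<close> in direction \<open>b\<close> is outside the support of \<open>\<phi>\<close>.\<close>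
    define a where "a = - (\<bar>R\<bar> + norm x + 1)"
    have "norm (x + a *\<^sub>R b) \<ge> norm (a *\<^sub>R b) - norm x" by (metis add.commute norm_diff_ineq)
    then have "norm (x + a *\<^sub>R b) > R" using b by (simp add: a_def)
    then have "x + a *\<^sub>R b \<notin> K" using R by force
    then have ha: "h a = 0" using out by (simp add: h_def)
    have hd: "(h has_real_derivative h' t) (at t)" for t
    proof -
      have d: "\<phi> differentiable (at y)" for y using C1 by simp
      have "((\<lambda>t. \<phi> (x + t *\<^sub>R b)) has_derivative (\<lambda>s. frechet_derivative \<phi> (at (x + t *\<^sub>R b)) (s *\<^sub>R b))) (at t)"
        by (rule has_derivative_compose[of "\<lambda>t. x + t *\<^sub>R b", OF _ d[THEN frechet_derivative_works[THEN iffD1]]])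
          (auto intro!: derivative_eq_intros)
      then have 1: "((\<lambda>t. \<phi> (x + t *\<^sub>R b)) has_real_derivative grad \<phi> (x + t *\<^sub>R b) \<bullet> b) (at t)"
        by (simp add: has_field_derivative_def frechet_derivative_grad[OF d] mult_commute_abs)
      show ?thesis unfolding h_def h'_def
        by (rule DERIV_chain'[OF 1 abs_powr_has_derivative, THEN DERIV_cong]) (use \<gamma> in auto)
    qed
    have ch: "continuous_on UNIV h'" unfolding h'_def
      using \<gamma>(1) by (intro continuous_on_mult continuous_on_inner continuous_on_add continuous_on_scaleR continuous_on_const
          continuous_on_id continuous_on_abs_powr continuous_on_compose2[OF c\<phi>] continuous_on_compose2[OF cg]) auto
    have "ennreal (h 0) \<le> (\<integral>\<^sup>+t. ennreal \<bar>h' t\<bar> \<partial>lborel)"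
      by (rule FTC_ennreal_bound[of a, OF _ ha hd ch]) (use norm_ge_zero[of x] in \<open>unfold a_def, linarith\<close>)
    also have "\<dots> \<le> (\<integral>\<^sup>+t. ennreal (\<gamma> * F (x + t *\<^sub>R b)) \<partial>lborel)"
    proof (intro nn_integral_mono ennreal_leI)
      fix t
      define y where "y = x + t *\<^sub>R b"
      have "\<bar>\<phi> y\<bar> * \<bar>\<phi> y\<bar> powr (\<gamma> - 2) = \<bar>\<phi> y\<bar> powr (\<gamma> - 1)"
        using powr_mult_base[of "\<bar>\<phi> y\<bar>" "\<gamma> - 2"] by (simp add: add_diff_eq[symmetric] diff_add_eq[symmetric])
      moreover have "\<bar>grad \<phi> y \<bullet> b\<bar> \<le> norm (grad \<phi> y)" using b by (rule Basis_le_norm)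
      ultimately show "\<bar>h' t\<bar> \<le> \<gamma> * F (x + t *\<^sub>R b)"
        using \<gamma> by (auto simp: h'_def F_def y_def[symmetric] abs_mult mult.assoc[symmetric] intro!: mult_left_mono)
    qed
    finally show ?thesis by (simp add: h_def)
  qed
  have F0: "0 \<le> F x" for x by (simp add: F_def)
  have "ennreal X = (\<integral>\<^sup>+x. ennreal ((\<bar>\<phi> x\<bar> powr \<gamma>) powr (m / (m - 1))) \<partial>lborel)"
    unfolding X_def using iq \<gamma>(3) by (simp add: nn_integral_eq_integral powr_powr)
  also have "\<dots> \<le> epow (\<integral>\<^sup>+x. ennreal (\<gamma> * F x) \<partial>lborel) (m / (m - 1))"
    unfolding m_def
  proof (rule gagliardo_nirenberg_lines)
    show "(\<lambda>x. ennreal (\<gamma> * F x)) \<in> borel_measurable borel"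
      using borel_measurable_continuous_onI[OF cF] by measurable
    show "(\<lambda>x. \<bar>\<phi> x\<bar> powr \<gamma>) \<in> borel_measurable borel"
      using borel_measurable_continuous_onI[OF c\<phi>] by measurable
  qed (use n lines in auto)
  also have "(\<integral>\<^sup>+x. ennreal (\<gamma> * F x) \<partial>lborel) = ennreal (\<gamma> * (\<integral>x. F x \<partial>lborel))"
    using iF F0 \<gamma>(1) by (subst nn_integral_eq_integral) auto
  also have "epow (ennreal (\<gamma> * (\<integral>x. F x \<partial>lborel))) (m / (m - 1)) \<le> epow (ennreal (\<gamma> * (X powr (1/2) * G powr (1/2)))) (m / (m - 1))"
    using m \<gamma> FX by (intro epow_mono ennreal_leI mult_left_mono) auto
  also have "\<dots> = ennreal ((\<gamma> * (X powr (1/2) * G powr (1/2))) powr (m / (m - 1)))"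
    using m \<gamma> by (intro epow_ennreal) auto
  finally have le: "X \<le> (\<gamma> * (X powr (1/2) * G powr (1/2))) powr (m / (m - 1))" by simp
  have "X powr ((m - 2) / m) \<le> \<gamma>\<^sup>2 * G"
  proof (cases "X = 0")
    case True
    then show ?thesis using G0 by simp
  next
    case False
    with X0 have X: "X > 0" by simp
    have "X powr ((m - 1) / m) \<le> ((\<gamma> * (X powr (1/2) * G powr (1/2))) powr (m / (m - 1))) powr ((m - 1) / m)"
      using le m X by (intro powr_mono2) auto
    also have "\<dots> = \<gamma> * (X powr (1/2) * G powr (1/2))"
      using m \<gamma> by (simp add: powr_powr)
    finally have "X powr ((m - 1) / m) / X powr (1/2) \<le> \<gamma> * G powr (1/2)"
      using X by (simp add: field_simps)
    then have "X powr ((m - 1) / m - 1/2) \<le> \<gamma> * G powr (1/2)" by (simp add: powr_diff)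
    then have "(X powr ((m - 1) / m - 1/2))\<^sup>2 \<le> (\<gamma> * G powr (1/2))\<^sup>2" by (intro power_mono) auto
    moreover have "(X powr ((m - 1) / m - 1/2))\<^sup>2 = X powr ((m - 2) / m)"
      using X m by (simp add: powr_power) (simp add: field_simps)
    moreover have "(\<gamma> * G powr (1/2))\<^sup>2 = \<gamma>\<^sup>2 * G"
      using G0 by (simp add: power_mult_distrib powr_half_sqrt)
    ultimately show ?thesis by simp
  qed
  then show ?thesis unfolding \<gamma>(4) by (simp add: X_def G_def \<gamma>_def)
qed


section \<open>Approximation by test functions and weak gradients\<close>

lemma Lp_norm_le_imp:
  assumes "Lp_norm \<Omega> p w \<le> ennreal e" "0 \<le> e" "0 < p"
  shows "(\<integral>\<^sup>+x. ennreal (norm (w x) powr p) \<partial>lebesgue_on \<Omega>) \<le> ennreal (e powr p)"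
proof -
  define I where "I = (\<integral>\<^sup>+x. ennreal (norm (w x) powr p) \<partial>lebesgue_on \<Omega>)"
  \<comment> \<open>An infinite integral would make the norm infinite by definition.\<close>
  have fin: "I \<noteq> \<infinity>" using assms(1) by (auto simp: Lp_norm_def Let_def I_def top_unique)
  then have "enn2real I powr (1 / p) \<le> e"
    using assms by (simp add: Lp_norm_def Let_def I_def[symmetric])
  then have "(enn2real I powr (1 / p)) powr p \<le> e powr p"
    using assms by (intro powr_mono2) auto
  then have "enn2real I \<le> e powr p" using assms by (simp add: powr_powr)
  moreover have "I = ennreal (enn2real I)" using fin by (simp add: ennreal_enn2real_if)
  ultimately show ?thesis unfolding I_def[symmetric] by (metis ennreal_leI)
qed

lemma Lp_2_D:
  assumes "w \<in> Lp \<Omega> 2"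
  shows "w \<in> borel_measurable (lebesgue_on \<Omega>)" "integrable (lebesgue_on \<Omega>) (\<lambda>x. (norm (w x))\<^sup>2)"
proof -
  show m [measurable]: "w \<in> borel_measurable (lebesgue_on \<Omega>)" using assms by (simp add: Lp_def)
  have fin: "Lp_norm \<Omega> 2 w < \<infinity>" using assms by (simp add: Lp_def)
  then obtain e where e: "Lp_norm \<Omega> 2 w = ennreal e" "0 \<le> e" by (cases "Lp_norm \<Omega> 2 w") auto
  have "(\<integral>\<^sup>+x. ennreal (norm (w x) powr 2) \<partial>lebesgue_on \<Omega>) \<le> ennreal (e powr 2)"
    by (rule Lp_norm_le_imp) (use e in auto)
  then show "integrable (lebesgue_on \<Omega>) (\<lambda>x. (norm (w x))\<^sup>2)"
    by (intro integrableI_bounded) (auto intro: le_less_trans)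
qed

lemma measurable_test_function:
  assumes "open \<Omega>" "\<phi> \<in> test_functions \<Omega>"
  shows "\<phi> \<in> borel_measurable (lebesgue_on \<Omega>)" "grad \<phi> \<in> borel_measurable (lebesgue_on \<Omega>)"
proof -
  have "\<Omega> \<in> sets lebesgue" using assms(1) by auto
  then show "\<phi> \<in> borel_measurable (lebesgue_on \<Omega>)" "grad \<phi> \<in> borel_measurable (lebesgue_on \<Omega>)"
    using C_k_continuous[OF test_functions_C_k[OF assms(2)]] continuous_on_grad[OF test_functions_C_k[OF assms(2)]]
    by (auto intro!: continuous_imp_measurable_on_sets_lebesgue intro: continuous_on_subset)
qed

lemma norm_power2_le_triangle:
  fixes a b :: "'a::real_normed_vector"
  shows "(norm a)\<^sup>2 \<le> 2 * (norm b)\<^sup>2 + 2 * (norm (a - b))\<^sup>2"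
proof -
  have "norm a \<le> norm b + norm (a - b)" by (metis add.commute diff_add_cancel norm_triangle_ineq)
  then have "(norm a)\<^sup>2 \<le> (norm b + norm (a - b))\<^sup>2" by (intro power_mono) auto
  also have "\<dots> \<le> 2 * (norm b)\<^sup>2 + 2 * (norm (a - b))\<^sup>2"
    using zero_le_power2[of "norm b - norm (a - b)"] by (simp add: power2_eq_square algebra_simps)
  finally show ?thesis .
qed

text \<open>
Choose approximating test functions whose squared distances to \<open>u\<close> are summable. The sum \<open>E\<close> of all
squared errors is integrable, hence finite almost everywhere; there the errors tend to 0, and \<open>u\<close>, \<open>G\<close> and
\<open>E\<close> dominate the whole sequence. This gives the hypotheses of the dominated convergence theorem in one stroke.
\<close>
lemma H10_dominated_approximation:
  fixes \<Omega> :: "'a::euclidean_space set"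
  assumes \<Omega>: "open \<Omega>" and u: "u \<in> H10 \<Omega>"
  obtains G \<phi> D where "G \<in> Lp \<Omega> 2" "has_weak_gradient \<Omega> u G" "\<And>j::nat. \<phi> j \<in> test_functions \<Omega>"
    "AE x in lebesgue_on \<Omega>. (\<lambda>j. \<phi> j x) \<longlonglongrightarrow> u x"
    "AE x in lebesgue_on \<Omega>. (\<lambda>j. grad (\<phi> j) x) \<longlonglongrightarrow> G x"
    "integrable (lebesgue_on \<Omega>) D"
    "AE x in lebesgue_on \<Omega>. \<forall>j. (\<phi> j x)\<^sup>2 \<le> D x"
    "AE x in lebesgue_on \<Omega>. \<forall>j. (norm (grad (\<phi> j) x))\<^sup>2 \<le> D x"
proof -
  let ?M = "lebesgue_on \<Omega>"
  from u obtain G \<phi> where u2: "u \<in> Lp \<Omega> 2" and G: "G \<in> Lp \<Omega> 2" "has_weak_gradient \<Omega> u G"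
    and \<phi>: "\<And>k::nat. \<phi> k \<in> test_functions \<Omega>"
    and l1: "(\<lambda>k. Lp_norm \<Omega> 2 (\<lambda>x. \<phi> k x - u x)) \<longlonglongrightarrow> 0"
    and l2: "(\<lambda>k. Lp_norm \<Omega> 2 (\<lambda>x. grad (\<phi> k) x - G x)) \<longlonglongrightarrow> 0"
    unfolding H10_def by blast
  note [measurable] = Lp_2_D(1)[OF u2] Lp_2_D(1)[OF G(1)] measurable_test_function[OF \<Omega> \<phi>]
  have "\<exists>k. Lp_norm \<Omega> 2 (\<lambda>x. \<phi> k x - u x) \<le> ennreal ((1/2)^j) \<and>
            Lp_norm \<Omega> 2 (\<lambda>x. grad (\<phi> k) x - G x) \<le> ennreal ((1/2)^j)" for j :: nat
  proof -
    have "eventually (\<lambda>k. Lp_norm \<Omega> 2 (\<lambda>x. \<phi> k x - u x) < ennreal ((1/2)^j)) sequentially"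
      by (rule order_tendstoD(2)[OF l1]) simp
    moreover have "eventually (\<lambda>k. Lp_norm \<Omega> 2 (\<lambda>x. grad (\<phi> k) x - G x) < ennreal ((1/2)^j)) sequentially"
      by (rule order_tendstoD(2)[OF l2]) simp
    ultimately have "eventually (\<lambda>k. Lp_norm \<Omega> 2 (\<lambda>x. \<phi> k x - u x) \<le> ennreal ((1/2)^j) \<and>
            Lp_norm \<Omega> 2 (\<lambda>x. grad (\<phi> k) x - G x) \<le> ennreal ((1/2)^j)) sequentially"
      by eventually_elim auto
    then show ?thesis by (rule eventually_happens'[rotated]) simp
  qed
  then obtain s where s: "\<And>j::nat. Lp_norm \<Omega> 2 (\<lambda>x. \<phi> (s j) x - u x) \<le> ennreal ((1/2)^j)"
    "\<And>j::nat. Lp_norm \<Omega> 2 (\<lambda>x. grad (\<phi> (s j)) x - G x) \<le> ennreal ((1/2)^j)" by metis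
  define e where "e j x = (norm (\<phi> (s j) x - u x))\<^sup>2 + (norm (grad (\<phi> (s j)) x - G x))\<^sup>2" for j x
  have e0: "0 \<le> e j x" for j x by (simp add: e_def)
  have em [measurable]: "e j \<in> borel_measurable ?M" for j unfolding e_def by measurable
  have ie: "(\<integral>\<^sup>+x. ennreal (e j x) \<partial>?M) \<le> ennreal (2 * (1/2)^j)" for j
  proof -
    have pw: "((1/2)^j) powr 2 \<le> (1/2::real)^j"
      by (simp add: power_mult[symmetric] power_decreasing)
    have "(\<integral>\<^sup>+x. ennreal (e j x) \<partial>?M)
        = (\<integral>\<^sup>+x. ennreal (norm (\<phi> (s j) x - u x) powr 2) + ennreal (norm (grad (\<phi> (s j)) x - G x) powr 2) \<partial>?M)"
      by (simp add: e_def)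
    also have "\<dots> = (\<integral>\<^sup>+x. ennreal (norm (\<phi> (s j) x - u x) powr 2) \<partial>?M)
       + (\<integral>\<^sup>+x. ennreal (norm (grad (\<phi> (s j)) x - G x) powr 2) \<partial>?M)"
      by (rule nn_integral_add) measurable
    also have "\<dots> \<le> ennreal (((1/2)^j) powr 2) + ennreal (((1/2)^j) powr 2)"
      by (intro add_mono Lp_norm_le_imp s) auto
    also have "\<dots> \<le> ennreal ((1/2)^j) + ennreal ((1/2)^j)"
      using pw by (intro add_mono ennreal_leI)
    also have "\<dots> = ennreal (2 * (1/2)^j)" by (subst ennreal_plus[symmetric]) auto
    finally show ?thesis .
  qed
  define E where "E x = (\<Sum>j. ennreal (e j x))" for x
  have [measurable]: "E \<in> borel_measurable ?M" unfolding E_def by measurable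
  have "(\<integral>\<^sup>+x. E x \<partial>?M) = (\<Sum>j. \<integral>\<^sup>+x. ennreal (e j x) \<partial>?M)"
    unfolding E_def by (rule nn_integral_suminf) measurable
  also have "\<dots> \<le> (\<Sum>j. ennreal (2 * (1/2)^j))" by (intro suminf_le ie) auto
  also have "\<dots> = ennreal (\<Sum>j. 2 * (1/2)^j)"
    by (rule suminf_ennreal2) (auto intro!: summable_mult summable_geometric)
  finally have Efin: "(\<integral>\<^sup>+x. E x \<partial>?M) < \<infinity>" by (simp add: le_less_trans)
  have AEfin: "AE x in ?M. E x \<noteq> \<infinity>" by (rule nn_integral_PInf_AE) (use Efin in auto)
  have iE: "integrable ?M (\<lambda>x. enn2real (E x))"
  proof (rule integrableI_bounded)
    have "(\<integral>\<^sup>+x. ennreal (norm (enn2real (E x))) \<partial>?M) \<le> (\<integral>\<^sup>+x. E x \<partial>?M)"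
      by (intro nn_integral_mono) (simp add: ennreal_enn2real_if)
    then show "(\<integral>\<^sup>+x. ennreal (norm (enn2real (E x))) \<partial>?M) < \<infinity>" using Efin by (rule le_less_trans)
  qed measurable
  define D where "D x = 2 * (norm (u x))\<^sup>2 + 2 * (norm (G x))\<^sup>2 + 2 * enn2real (E x)" for x
  have iD: "integrable ?M D" unfolding D_def
    using Lp_2_D(2)[OF u2] Lp_2_D(2)[OF G(1)] iE by auto
  have pt: "(\<lambda>j. \<phi> (s j) x) \<longlonglongrightarrow> u x \<and> (\<lambda>j. grad (\<phi> (s j)) x) \<longlonglongrightarrow> G x \<and>
     (\<forall>j. (\<phi> (s j) x)\<^sup>2 \<le> D x) \<and> (\<forall>j. (norm (grad (\<phi> (s j)) x))\<^sup>2 \<le> D x)" if fin: "E x \<noteq> \<infinity>" for x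
  proof -
    have sm: "summable (\<lambda>j. e j x)"
      by (rule summable_suminf_not_top) (use fin e0 in \<open>auto simp: E_def\<close>)
    have E: "enn2real (E x) = (\<Sum>j. e j x)"
      unfolding E_def using sm e0 by (subst suminf_ennreal2) (auto intro: suminf_nonneg simp: enn2real_ennreal[OF suminf_nonneg])
    have le: "e j x \<le> enn2real (E x)" for j
      unfolding E using sum_le_suminf[OF sm, of "{j}"] e0 by auto
    have "(\<lambda>j. e j x) \<longlonglongrightarrow> 0" by (rule summable_LIMSEQ_zero[OF sm])
    then have "(\<lambda>j. sqrt (e j x)) \<longlonglongrightarrow> 0" using tendsto_real_sqrt[of _ 0] by force
    note sq = this
    have nb: "norm (\<phi> (s j) x - u x) \<le> sqrt (e j x)" "norm (grad (\<phi> (s j)) x - G x) \<le> sqrt (e j x)" for j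
      by (auto simp: e_def intro!: real_le_rsqrt)
    have "(\<lambda>j. \<phi> (s j) x - u x) \<longlonglongrightarrow> 0" "(\<lambda>j. grad (\<phi> (s j)) x - G x) \<longlonglongrightarrow> 0"
      by (rule Lim_null_comparison[OF always_eventually[OF allI] sq], rule nb)+
    moreover
    have "(\<phi> (s j) x)\<^sup>2 \<le> D x" for j
    proof -
      have "(norm (\<phi> (s j) x - u x))\<^sup>2 \<le> e j x" by (simp add: e_def)
      then show ?thesis using norm_power2_le_triangle[of "\<phi> (s j) x" "u x"] le[of j] zero_le_power2[of "norm (G x)"]
        unfolding D_def real_norm_def power2_abs by linarith
    qed
    moreover have "(norm (grad (\<phi> (s j)) x))\<^sup>2 \<le> D x" for j
    proof -
      have "(norm (grad (\<phi> (s j)) x - G x))\<^sup>2 \<le> e j x" by (simp add: e_def)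
      then show ?thesis using norm_power2_le_triangle[of "grad (\<phi> (s j)) x" "G x"] le[of j] zero_le_power2[of "norm (u x)"]
        unfolding D_def real_norm_def power2_abs by linarith
    qed
    ultimately show ?thesis by (auto simp: LIM_zero_iff)
  qed
  show ?thesis
    by (rule that[of G "\<lambda>j. \<phi> (s j)" D])
      (use G \<phi> iD AEfin pt in \<open>auto elim!: eventually_mono\<close>)
qed

lemma integral_lebesgue_on_zero_outside:
  fixes h :: "'a::euclidean_space \<Rightarrow> real"
  assumes "open \<Omega>" "h \<in> borel_measurable borel" "\<And>x. x \<notin> \<Omega> \<Longrightarrow> h x = 0"
  shows "(LINT x|lebesgue_on \<Omega>. h x) = (LINT x|lborel. h x)"
proof -
  have "(LINT x|lebesgue_on \<Omega>. h x) = (LINT x|lebesgue. indicator \<Omega> x *\<^sub>R h x)"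
    using assms(1) by (subst integral_restrict_space) auto
  also have "(\<lambda>x. indicator \<Omega> x *\<^sub>R h x) = h" using assms(3) by (auto simp: indicator_def fun_eq_iff)
  finally show ?thesis using assms(2) by (simp add: integral_completion)
qed

lemma test_function_outside:
  assumes "\<phi> \<in> test_functions \<Omega>" "x \<notin> \<Omega>"
  shows "\<phi> x = 0" "grad \<phi> x = 0"
proof -
  have "x \<notin> closure {x. \<phi> x \<noteq> 0}" using assms by (auto simp: test_functions_def)
  then show "\<phi> x = 0" "grad \<phi> x = 0"
    using subsetD[OF closure_subset, of x "{x. \<phi> x \<noteq> 0}"] grad_outside_support[of x \<phi>] by auto
qed

lemma sobolev_test_function:
  fixes \<phi> :: "'a::euclidean_space \<Rightarrow> real"
  assumes n: "DIM('a) > 2" and \<Omega>: "open \<Omega>" and \<phi>: "\<phi> \<in> test_functions \<Omega>"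
  defines "m \<equiv> real DIM('a)" and "q \<equiv> crit_exp DIM('a)"
  shows "(LINT x|lebesgue_on \<Omega>. \<bar>\<phi> x\<bar> powr q) powr (2 / q)
          \<le> (2 * (m - 1) / (m - 2))\<^sup>2 * (LINT x|lebesgue_on \<Omega>. (norm (grad \<phi> x))\<^sup>2)"
proof -
  have [measurable]: "\<phi> \<in> borel_measurable borel" "grad \<phi> \<in> borel_measurable borel"
    using C_k_continuous[OF test_functions_C_k[OF \<phi>]] continuous_on_grad[OF test_functions_C_k[OF \<phi>]]
    by (auto intro: borel_measurable_continuous_onI)
  have "(LINT x|lebesgue_on \<Omega>. \<bar>\<phi> x\<bar> powr q) = (LINT x|lborel. \<bar>\<phi> x\<bar> powr q)"
    by (rule integral_lebesgue_on_zero_outside[OF \<Omega>]) (use test_function_outside[OF \<phi>] in auto)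
  moreover have "(LINT x|lebesgue_on \<Omega>. (norm (grad \<phi> x))\<^sup>2) = (LINT x|lborel. (norm (grad \<phi> x))\<^sup>2)"
    by (rule integral_lebesgue_on_zero_outside[OF \<Omega>]) (use test_function_outside[OF \<phi>] in auto)
  ultimately show ?thesis
    using sobolev_inequality[OF n test_functions_C_k[OF \<phi>]] \<phi> unfolding m_def q_def
    by (simp add: test_functions_def)
qed

lemma integrable_L1_loc_test_function:
  fixes G :: "'a::euclidean_space \<Rightarrow> 'b::euclidean_space"
  assumes \<Omega>: "open \<Omega>" and G: "G \<in> L1_loc \<Omega>" and \<phi>: "\<phi> \<in> test_functions \<Omega>"
  shows "integrable (lebesgue_on \<Omega>) (\<lambda>x. \<phi> x *\<^sub>R G x)"
proof -
  define K where "K = closure {x. \<phi> x \<noteq> 0}"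
  have K: "compact K" "K \<subseteq> \<Omega>" using \<phi> by (auto simp: K_def test_functions_def)
  have Km: "K \<in> sets lebesgue" using K(1) by (simp add: lmeasurable_compact fmeasurableD)
  have c\<phi>: "continuous_on UNIV \<phi>" by (rule C_k_continuous[OF test_functions_C_k[OF \<phi>]])
  have out: "\<phi> x = 0" if "x \<notin> K" for x
    using that subsetD[OF closure_subset, of x "{x. \<phi> x \<noteq> 0}"] by (auto simp: K_def)
  obtain B where B: "\<And>x. x \<in> K \<Longrightarrow> norm (\<phi> x) \<le> B"
    using compact_imp_bounded[OF compact_continuous_image[OF continuous_on_subset[OF c\<phi>] K(1)]]
    by (auto simp: bounded_iff)
  have iG: "integrable (lebesgue_on K) G" using G K by (auto simp: L1_loc_def)
  have "integrable (lebesgue_on K) (\<lambda>x. \<phi> x *\<^sub>R G x)"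
  proof (rule Bochner_Integration.integrable_bound[OF integrable_mult_right[OF integrable_norm[OF iG], of B]])
    have "\<phi> \<in> borel_measurable (lebesgue_on K)"
      by (rule continuous_imp_measurable_on_sets_lebesgue[OF continuous_on_subset[OF c\<phi>] Km]) auto
    then show "(\<lambda>x. \<phi> x *\<^sub>R G x) \<in> borel_measurable (lebesgue_on K)" using iG by measurable
    show "AE x in lebesgue_on K. norm (\<phi> x *\<^sub>R G x) \<le> norm (B * norm (G x))"
    proof (rule AE_I2)
      fix x assume "x \<in> space (lebesgue_on K)"
      then have "norm (\<phi> x) \<le> B" using B by simp
      then show "norm (\<phi> x *\<^sub>R G x) \<le> norm (B * norm (G x))"
        by (simp add: abs_mult mult_right_mono)
    qed
  qed
  then have "integrable lebesgue (\<lambda>x. indicator K x *\<^sub>R (\<phi> x *\<^sub>R G x))"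
    using Km by (subst (asm) integrable_restrict_space) auto
  moreover have "(\<lambda>x. indicator K x *\<^sub>R (\<phi> x *\<^sub>R G x)) = (\<lambda>x. indicator \<Omega> x *\<^sub>R (\<phi> x *\<^sub>R G x))"
    using out K(2) by (auto simp: indicator_def fun_eq_iff)
  ultimately show ?thesis using \<Omega> by (subst integrable_restrict_space) auto
qed

text \<open>
Partial derivatives of test functions are test functions, so the pairing of a weak gradient with \<open>grad \<phi>\<close> is
determined by \<open>u\<close>. This lets the gradient in the definition of \<open>H10\<close> take the place of the one in the
definition of a weak solution.
\<close>
lemma weak_gradient_against_grad:
  fixes \<Omega> :: "'a::euclidean_space set"
  assumes \<Omega>: "open \<Omega>" and G: "has_weak_gradient \<Omega> u G" and \<phi>: "\<phi> \<in> test_functions \<Omega>"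
  shows "(LINT x|lebesgue_on \<Omega>. G x \<bullet> grad \<phi> x)
     = - (\<Sum>b\<in>Basis. LINT x|lebesgue_on \<Omega>. u x * partial_deriv b (partial_deriv b \<phi>) x)"
proof -
  have int: "integrable (lebesgue_on \<Omega>) (\<lambda>x. (G x \<bullet> b) * partial_deriv b \<phi> x)" if b: "b \<in> Basis" for b
  proof -
    have "integrable (lebesgue_on \<Omega>) (\<lambda>x. (partial_deriv b \<phi> x *\<^sub>R G x) \<bullet> b)"
      using G by (intro integrable_inner_left integrable_L1_loc_test_function \<Omega> test_functions_partial_deriv \<phi> b)
        (auto simp: has_weak_gradient_def)
    then show ?thesis by (simp add: mult.commute)
  qed
  have "(LINT x|lebesgue_on \<Omega>. G x \<bullet> grad \<phi> x)
      = (LINT x|lebesgue_on \<Omega>. (\<Sum>b\<in>Basis. (G x \<bullet> b) * partial_deriv b \<phi> x))"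
    by (simp add: grad_def inner_sum_right mult.commute)
  also have "\<dots> = (\<Sum>b\<in>Basis. LINT x|lebesgue_on \<Omega>. (G x \<bullet> b) * partial_deriv b \<phi> x)"
    by (rule Bochner_Integration.integral_sum) (use int in auto)
  also have "\<dots> = (\<Sum>b\<in>Basis. - (LINT x|lebesgue_on \<Omega>. u x * partial_deriv b (partial_deriv b \<phi>) x))"
    using G test_functions_partial_deriv[OF \<phi>] by (intro sum.cong refl) (simp add: has_weak_gradient_def)
  finally show ?thesis by (simp add: sum_negf)
qed


section \<open>The energy inequality\<close>

lemma finite_measure_lebesgue_on_bounded_open:
  assumes "open \<Omega>" "bounded \<Omega>"
  shows "finite_measure (lebesgue_on \<Omega>)"
  by (rule finite_measure_lebesgue_on) (use assms lmeasurable_open in auto)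

lemma derivative_bound_imp_abs_le:
  fixes H :: "real \<Rightarrow> real"
  assumes "\<And>s. (H has_real_derivative h s) (at s)" "H 0 = 0" "0 \<le> R"
    and "\<And>s. \<bar>s\<bar> \<le> R \<Longrightarrow> \<bar>h s\<bar> \<le> B" "\<bar>s\<bar> \<le> R"
  shows "\<bar>H s\<bar> \<le> B * \<bar>s\<bar>"
proof -
  have "norm (H s - H 0) \<le> B * norm (s - 0)"
    by (rule field_differentiable_bound[of "{-R..R}" H h])
      (use assms in \<open>auto intro: has_field_derivative_at_within\<close>)
  then show ?thesis using assms(2) by simp
qed

text \<open>
For test functions \<open>\<phi>\<^sub>j\<close> approximating \<open>u\<close>, both \<open>\<Phi>(\<phi>\<^sub>j)\<close> and \<open>\<Psi>(\<phi>\<^sub>j)\<close> are again test functions.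
Testing the equation with the former and letting \<open>j\<close> tend to infinity identifies
\<open>\<integral>(\<psi>(u))\<^sup>2 |G|\<^sup>2\<close> with \<open>\<integral>f(x, u) \<Phi>(u)\<close>; the same integral is the limit of the Dirichlet integrals
of \<open>\<Psi>(\<phi>\<^sub>j)\<close>, to which the Sobolev inequality applies, and Fatou's lemma takes care of its other side.
\<close>
lemma energy_inequality_smooth:
  fixes \<Omega> :: "'a::euclidean_space set" and \<psi> \<Psi> \<Phi> :: "real \<Rightarrow> real"
  assumes n: "DIM('a) > 2" and \<Omega>: "open \<Omega>" "bounded \<Omega>" and sol: "weak_solution \<Omega> f u"
    and gm: "(\<lambda>x. f x (u x)) \<in> borel_measurable (lebesgue_on \<Omega>)"
    and gB: "AE x in lebesgue_on \<Omega>. \<bar>f x (u x)\<bar> \<le> Bg"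
    and \<psi>: "\<And>k. C_k k \<psi>" "\<And>s. \<bar>\<psi> s\<bar> \<le> B"
    and \<Psi>: "\<And>s. (\<Psi> has_real_derivative \<psi> s) (at s)" "\<Psi> 0 = 0"
    and \<Phi>: "\<And>s. (\<Phi> has_real_derivative (\<psi> s)\<^sup>2) (at s)" "\<Phi> 0 = 0"
  defines "m \<equiv> real DIM('a)" and "q \<equiv> crit_exp DIM('a)"
  shows "(LINT x|lebesgue_on \<Omega>. \<bar>\<Psi> (u x)\<bar> powr q) powr (2 / q)
          \<le> (2 * (m - 1) / (m - 2))\<^sup>2 * (LINT x|lebesgue_on \<Omega>. f x (u x) * \<Phi> (u x))"
proof -
  let ?M = "lebesgue_on \<Omega>"
  interpret finite_measure ?M by (rule finite_measure_lebesgue_on_bounded_open[OF \<Omega>])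
  have uH: "u \<in> H10 \<Omega>" using sol by (simp add: weak_solution_def)
  obtain G \<phi> D where G: "G \<in> Lp \<Omega> 2" "has_weak_gradient \<Omega> u G" and \<phi>: "\<And>j::nat. \<phi> j \<in> test_functions \<Omega>"
    and lim\<phi>: "AE x in ?M. (\<lambda>j. \<phi> j x) \<longlonglongrightarrow> u x"
    and limG: "AE x in ?M. (\<lambda>j. grad (\<phi> j) x) \<longlonglongrightarrow> G x"
    and D: "integrable ?M D" "AE x in ?M. \<forall>j. (\<phi> j x)\<^sup>2 \<le> D x"
      "AE x in ?M. \<forall>j. (norm (grad (\<phi> j) x))\<^sup>2 \<le> D x"
    by (rule H10_dominated_approximation[OF \<Omega>(1) uH], rule that)
  obtain G' where G': "has_weak_gradient \<Omega> u G'"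
    and weak: "\<And>\<eta>. \<eta> \<in> test_functions \<Omega> \<Longrightarrow> (LINT x|?M. G' x \<bullet> grad \<eta> x) = (LINT x|?M. f x (u x) * \<eta> x)"
    using sol by (auto simp: weak_solution_def)
  have um [measurable]: "u \<in> borel_measurable ?M" using uH by (auto simp: H10_def Lp_def)
  note [measurable] = Lp_2_D(1)[OF G(1)] measurable_test_function[OF \<Omega>(1) \<phi>] gm
  have iG: "integrable ?M (\<lambda>x. (norm (G x))\<^sup>2)" by (rule Lp_2_D(2)[OF G(1)])
  have B0: "0 \<le> B" using \<psi>(2)[of 0] by linarith
  have \<psi>c: "isCont \<psi> s" for s
    using C_k_continuous[OF \<psi>(1)[of 0]] by (auto simp: continuous_on_eq_continuous_at)
  have \<Psi>c: "isCont \<Psi> s" and \<Phi>c: "isCont \<Phi> s" for s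
    using \<Psi>(1)[of s] \<Phi>(1)[of s] DERIV_isCont by blast+
  have [measurable]: "\<psi> \<in> borel_measurable borel" "\<Psi> \<in> borel_measurable borel" "\<Phi> \<in> borel_measurable borel"
    by (auto intro!: borel_measurable_continuous_onI simp: continuous_on_eq_continuous_at \<psi>c \<Psi>c \<Phi>c)
  have \<psi>2: "(\<psi> s)\<^sup>2 \<le> B\<^sup>2" for s using \<psi>(2)[of s] B0 by (metis abs_le_square_iff abs_of_nonneg)
  have \<Phi>le: "\<bar>\<Phi> s\<bar> \<le> B\<^sup>2 * \<bar>s\<bar>" for s
    by (rule derivative_bound_imp_abs_le[OF \<Phi>, of "\<bar>s\<bar>"]) (use \<psi>2 in auto)
  have \<Psi>C: "C_k k \<Psi>" for k
    using C_k_Suc_D[OF C_k_of_real_derivative[OF \<Psi>(1) \<psi>(1)]] .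
  have \<Phi>C: "C_k k \<Phi>" for k
    using C_k_Suc_D[OF C_k_of_real_derivative[OF \<Phi>(1) C_k_power[OF \<psi>(1)]]] .
  have d\<phi>: "\<phi> j differentiable (at x)" for j x
    using test_functions_C_k[OF \<phi>, of "Suc 0" j] by simp
  have t\<Phi>: "(\<lambda>x. \<Phi> (\<phi> j x)) \<in> test_functions \<Omega>" and t\<Psi>: "(\<lambda>x. \<Psi> (\<phi> j x)) \<in> test_functions \<Omega>" for j
    using test_functions_compose[OF \<phi> \<Phi>C \<Phi>(2)] test_functions_compose[OF \<phi> \<Psi>C \<Psi>(2)] by auto
  have gr\<Phi>: "grad (\<lambda>x. \<Phi> (\<phi> j x)) x = (\<psi> (\<phi> j x))\<^sup>2 *\<^sub>R grad (\<phi> j) x" for j x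
    by (rule grad_compose[OF \<Phi>(1) d\<phi>])
  have gr\<Psi>: "grad (\<lambda>x. \<Psi> (\<phi> j x)) x = \<psi> (\<phi> j x) *\<^sub>R grad (\<phi> j) x" for j x
    by (rule grad_compose[OF \<Psi>(1) d\<phi>])
  define E where "E = (LINT x|?M. (\<psi> (u x))\<^sup>2 * (norm (G x))\<^sup>2)"
  have id: "(LINT x|?M. (\<psi> (\<phi> j x))\<^sup>2 * (G x \<bullet> grad (\<phi> j) x)) = (LINT x|?M. f x (u x) * \<Phi> (\<phi> j x))" for j
    using weak[OF t\<Phi>[of j]] weak_gradient_against_grad[OF \<Omega>(1) G(2) t\<Phi>[of j]]
      weak_gradient_against_grad[OF \<Omega>(1) G' t\<Phi>[of j]] by (simp add: gr\<Phi>)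
  have L1: "(\<lambda>j. LINT x|?M. (\<psi> (\<phi> j x))\<^sup>2 * (G x \<bullet> grad (\<phi> j) x)) \<longlonglongrightarrow> (LINT x|?M. (\<psi> (u x))\<^sup>2 * (G x \<bullet> G x))"
  proof (rule integral_dominated_convergence[where w = "\<lambda>x. B\<^sup>2 * ((norm (G x))\<^sup>2 + D x)"])
    show "integrable ?M (\<lambda>x. B\<^sup>2 * ((norm (G x))\<^sup>2 + D x))" using iG D by auto
    show "AE x in ?M. (\<lambda>j. (\<psi> (\<phi> j x))\<^sup>2 * (G x \<bullet> grad (\<phi> j) x)) \<longlonglongrightarrow> (\<psi> (u x))\<^sup>2 * (G x \<bullet> G x)"
      using lim\<phi> limG
      by eventually_elim (intro tendsto_intros isCont_tendsto_compose[OF \<psi>c])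
    show "AE x in ?M. norm ((\<psi> (\<phi> j x))\<^sup>2 * (G x \<bullet> grad (\<phi> j) x)) \<le> B\<^sup>2 * ((norm (G x))\<^sup>2 + D x)" for j
      using D(3)
    proof eventually_elim
      case (elim x)
      have "\<bar>G x \<bullet> grad (\<phi> j) x\<bar> \<le> norm (G x) * norm (grad (\<phi> j) x)" by (rule Cauchy_Schwarz_ineq2)
      also have "\<dots> \<le> (norm (G x))\<^sup>2 + (norm (grad (\<phi> j) x))\<^sup>2"
        using sum_squares_bound[of "norm (G x)" "norm (grad (\<phi> j) x)"]
          mult_nonneg_nonneg[OF norm_ge_zero[of "G x"] norm_ge_zero[of "grad (\<phi> j) x"]] by linarith
      also have "\<dots> \<le> (norm (G x))\<^sup>2 + D x" using elim by simp
      finally show ?case using \<psi>2[of "\<phi> j x"] by (auto simp: abs_mult intro!: mult_mono)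
    qed
  qed measurable
  have L2: "(\<lambda>j. LINT x|?M. f x (u x) * \<Phi> (\<phi> j x)) \<longlonglongrightarrow> (LINT x|?M. f x (u x) * \<Phi> (u x))"
  proof (rule integral_dominated_convergence[where w = "\<lambda>x. \<bar>Bg\<bar> * (B\<^sup>2 * (1 + D x))"])
    show "integrable ?M (\<lambda>x. \<bar>Bg\<bar> * (B\<^sup>2 * (1 + D x)))" using D by auto
    show "AE x in ?M. (\<lambda>j. f x (u x) * \<Phi> (\<phi> j x)) \<longlonglongrightarrow> f x (u x) * \<Phi> (u x)"
      using lim\<phi> by eventually_elim (intro tendsto_intros isCont_tendsto_compose[OF \<Phi>c])
    show "AE x in ?M. norm (f x (u x) * \<Phi> (\<phi> j x)) \<le> \<bar>Bg\<bar> * (B\<^sup>2 * (1 + D x))" for j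
      using D(2) gB
    proof eventually_elim
      case (elim x)
      have "\<bar>\<phi> j x\<bar> \<le> 1 + (\<phi> j x)\<^sup>2"
        using zero_le_power2[of "\<bar>\<phi> j x\<bar> - 1"] by (simp add: power2_diff)
      also have "\<dots> \<le> 1 + D x" using elim by simp
      finally have "B\<^sup>2 * \<bar>\<phi> j x\<bar> \<le> B\<^sup>2 * (1 + D x)" by (intro mult_left_mono) auto
      with \<Phi>le[of "\<phi> j x"] have "\<bar>\<Phi> (\<phi> j x)\<bar> \<le> B\<^sup>2 * (1 + D x)" by linarith
      then show ?case using elim by (auto simp: abs_mult intro!: mult_mono)
    qed
  qed measurable
  have E: "E = (LINT x|?M. f x (u x) * \<Phi> (u x))"
    using LIMSEQ_unique[OF L1 L2[folded id]] by (simp add: E_def power2_norm_eq_inner)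
  have L3: "(\<lambda>j. LINT x|?M. (norm (grad (\<lambda>x. \<Psi> (\<phi> j x)) x))\<^sup>2) \<longlonglongrightarrow> E"
    unfolding E_def gr\<Psi> norm_scaleR power_mult_distrib power2_abs
  proof (rule integral_dominated_convergence[where w = "\<lambda>x. B\<^sup>2 * D x"])
    show "integrable ?M (\<lambda>x. B\<^sup>2 * D x)" using D by auto
    show "AE x in ?M. (\<lambda>j. (\<psi> (\<phi> j x))\<^sup>2 * (norm (grad (\<phi> j) x))\<^sup>2) \<longlonglongrightarrow> (\<psi> (u x))\<^sup>2 * (norm (G x))\<^sup>2"
      using lim\<phi> limG by eventually_elim (intro tendsto_intros isCont_tendsto_compose[OF \<psi>c])
    show "AE x in ?M. norm ((\<psi> (\<phi> j x))\<^sup>2 * (norm (grad (\<phi> j) x))\<^sup>2) \<le> B\<^sup>2 * D x" for j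
      using D(3) by eventually_elim (use \<psi>2 in \<open>auto simp: abs_mult intro!: mult_mono\<close>)
  qed measurable
  define S where "S = (2 * (m - 1) / (m - 2))\<^sup>2"
  have S0: "0 \<le> S" by (simp add: S_def)
  have q: "q > 2" using n by (simp add: q_def crit_exp_def field_simps)
  have E0: "0 \<le> E" by (simp add: E_def)
  define X where "X j = (LINT x|?M. \<bar>\<Psi> (\<phi> j x)\<bar> powr q)" for j
  define Y where "Y j = (S * (LINT x|?M. (norm (grad (\<lambda>x. \<Psi> (\<phi> j x)) x))\<^sup>2)) powr (q / 2)" for j
  have XY: "X j \<le> Y j" for j
  proof -
    have "X j powr (2 / q) \<le> S * (LINT x|?M. (norm (grad (\<lambda>x. \<Psi> (\<phi> j x)) x))\<^sup>2)"
      unfolding X_def S_def m_def q_def by (rule sobolev_test_function[OF n \<Omega>(1) t\<Psi>])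
    then have "(X j powr (2 / q)) powr (q / 2) \<le> Y j"
      unfolding Y_def using q by (intro powr_mono2) auto
    moreover have "0 \<le> X j" by (simp add: X_def)
    ultimately show ?thesis using q by (simp add: powr_powr)
  qed
  have Ylim: "Y \<longlonglongrightarrow> (S * E) powr (q / 2)"
    unfolding Y_def using q S0 E0 L3
    by (intro tendsto_powr' tendsto_intros) (auto intro!: always_eventually)
  have nnX: "(\<integral>\<^sup>+x. ennreal (\<bar>\<Psi> (\<phi> j x)\<bar> powr q) \<partial>?M) = ennreal (X j)" for j
  proof -
    have cont: "continuous_on UNIV (\<lambda>x. \<bar>\<Psi> (\<phi> j x)\<bar> powr q)"
      using q C_k_continuous[OF test_functions_C_k[OF t\<Psi>]] by (intro continuous_on_abs_powr) auto
    have zero: "\<bar>\<Psi> (\<phi> j x)\<bar> powr q = 0" if "x \<notin> closure {x. \<Psi> (\<phi> j x) \<noteq> 0}" for x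
      using that subsetD[OF closure_subset, of x "{x. \<Psi> (\<phi> j x) \<noteq> 0}"] by auto
    have "integrable lborel (\<lambda>x. \<bar>\<Psi> (\<phi> j x)\<bar> powr q)"
      by (rule integrable_continuous_compact_support[OF cont _ zero])
        (use t\<Psi>[of j] in \<open>auto simp: test_functions_def\<close>)
    then have "integrable lebesgue (\<lambda>x. \<bar>\<Psi> (\<phi> j x)\<bar> powr q)"
      using borel_measurable_integrable[of lborel] by (subst integrable_completion) auto
    then have "integrable lebesgue (\<lambda>x. indicator \<Omega> x *\<^sub>R \<bar>\<Psi> (\<phi> j x)\<bar> powr q)"
      by (rule integrable_mult_indicator[rotated]) (use \<Omega>(1) in auto)
    then have "integrable ?M (\<lambda>x. \<bar>\<Psi> (\<phi> j x)\<bar> powr q)"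
      using \<Omega>(1) by (subst integrable_restrict_space) auto
    then show ?thesis unfolding X_def by (simp add: nn_integral_eq_integral)
  qed
  have "(\<integral>\<^sup>+x. ennreal (\<bar>\<Psi> (u x)\<bar> powr q) \<partial>?M) = (\<integral>\<^sup>+x. liminf (\<lambda>j. ennreal (\<bar>\<Psi> (\<phi> j x)\<bar> powr q)) \<partial>?M)"
  proof (rule nn_integral_cong_AE)
    show "AE x in ?M. ennreal (\<bar>\<Psi> (u x)\<bar> powr q) = liminf (\<lambda>j. ennreal (\<bar>\<Psi> (\<phi> j x)\<bar> powr q))"
      using lim\<phi>
    proof eventually_elim
      case (elim x)
      have "(\<lambda>j. ennreal (\<bar>\<Psi> (\<phi> j x)\<bar> powr q)) \<longlonglongrightarrow> ennreal (\<bar>\<Psi> (u x)\<bar> powr q)"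
        using q by (intro tendsto_ennrealI tendsto_powr' tendsto_intros isCont_tendsto_compose[OF \<Psi>c elim]) auto
      then show ?case by (intro lim_imp_Liminf[symmetric]) auto
    qed
  qed
  also have "\<dots> \<le> liminf (\<lambda>j. \<integral>\<^sup>+x. ennreal (\<bar>\<Psi> (\<phi> j x)\<bar> powr q) \<partial>?M)"
    by (rule nn_integral_liminf) measurable
  also have "\<dots> \<le> liminf (\<lambda>j. ennreal (Y j))"
    by (intro Liminf_mono always_eventually allI) (simp add: nnX ennreal_leI XY)
  also have "\<dots> = ennreal ((S * E) powr (q / 2))"
    by (intro lim_imp_Liminf tendsto_ennrealI Ylim) auto
  finally have le: "(\<integral>\<^sup>+x. ennreal (\<bar>\<Psi> (u x)\<bar> powr q) \<partial>?M) \<le> ennreal ((S * E) powr (q / 2))" .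
  then have "integrable ?M (\<lambda>x. \<bar>\<Psi> (u x)\<bar> powr q)"
    by (intro integrableI_bounded) (auto intro: le_less_trans)
  then have "(LINT x|?M. \<bar>\<Psi> (u x)\<bar> powr q) \<le> (S * E) powr (q / 2)"
    using le by (simp add: nn_integral_eq_integral)
  then have "(LINT x|?M. \<bar>\<Psi> (u x)\<bar> powr q) powr (2 / q) \<le> ((S * E) powr (q / 2)) powr (2 / q)"
    using q by (intro powr_mono2) auto
  also have "\<dots> = S * E" using q S0 E0 by (simp add: powr_powr)
  finally show ?thesis by (simp add: S_def E)
qed

text \<open>
A polynomial approximation of \<open>\<psi>\<close> would be unbounded on the line. Polynomials in \<open>sin (s / R)\<close> are
bounded and smooth, and on \<open>[-R, R]\<close> they approximate every continuous function, since \<open>sin (s / R)\<close> is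
injective there.
\<close>
lemma bounded_smooth_approximation:
  fixes \<psi> :: "real \<Rightarrow> real"
  assumes \<psi>: "continuous_on UNIV \<psi>" and R: "0 < R" and e: "0 < e"
  obtains \<rho> B where "\<And>k. C_k k \<rho>" "\<And>s. \<bar>\<rho> s\<bar> \<le> B" "\<And>s. \<bar>s\<bar> \<le> R \<Longrightarrow> \<bar>\<rho> s - \<psi> s\<bar> \<le> e"
proof -
  define h where "h y = \<psi> (R * arcsin (2 * y - 1))" for y
  have "continuous_on {0..1} h" unfolding h_def
    by (intro continuous_on_compose2[OF \<psi>] continuous_intros) auto
  from Bernstein_Weierstrass[OF this e]
  obtain N where N: "\<And>n x. N \<le> n \<Longrightarrow> x \<in> {0..1} \<Longrightarrow> \<bar>h x - (\<Sum>k\<le>n. h (k / n) * Bernstein n k x)\<bar> < e" by blast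
  define P where "P x = (\<Sum>k\<le>N. h (k / N) * Bernstein N k x)" for x
  \<comment> \<open>Rescaled to the interval \<open>[0, 1]\<close> on which Bernstein polynomials approximate.\<close>
  define y where "y s = (1 + sin ((1 / R) * s)) * (1 / 2)" for s :: real
  have y01: "y s \<in> {0..1}" for s
  proof -
    have "0 \<le> 1 + sin (1 / R * s)" "1 + sin (1 / R * s) \<le> 2"
      using sin_ge_minus_one[of "1 / R * s"] sin_le_one[of "1 / R * s"] by linarith+
    then show ?thesis by (auto simp: y_def)
  qed
  have yC: "C_k k y" for k
  proof -
    have "C_k k (\<lambda>s. sin ((1 / R) * s))"
      by (rule C_k_compose[OF conjunct1[OF C_k_sin_cos] C_k_mult[OF C_k_const C_k_id]])
    then show ?thesis unfolding y_def by (intro C_k_mult C_k_add C_k_const)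
  qed
  have PC: "C_k k P" for k
  proof -
    have "C_k k (\<lambda>x. 1 + (-1) * x :: real)" by (rule C_k_add[OF C_k_const C_k_mult[OF C_k_const C_k_id]])
    then have "C_k k (\<lambda>x. 1 - x :: real)" by simp
    then show ?thesis unfolding P_def Bernstein_def
      by (intro C_k_sum C_k_mult C_k_power C_k_const C_k_id)
  qed
  have "bounded (P ` {0..1})"
    by (intro compact_imp_bounded compact_continuous_image continuous_on_subset[OF C_k_continuous[OF PC[of 0]]]) auto
  then obtain B where "\<forall>z\<in>P ` {0..1}. norm z \<le> B" unfolding bounded_iff by blast
  then have B: "\<And>x. x \<in> {0..1} \<Longrightarrow> \<bar>P x\<bar> \<le> B" by simp
  show ?thesis
  proof (rule that[of "\<lambda>s. P (y s)" B])
    show "C_k k (\<lambda>s. P (y s))" for k by (rule C_k_compose[OF PC yC])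
    show "\<bar>P (y s)\<bar> \<le> B" for s by (rule B[OF y01])
    show "\<bar>P (y s) - \<psi> s\<bar> \<le> e" if "\<bar>s\<bar> \<le> R" for s
    proof -
      have "\<bar>s / R\<bar> \<le> 1" using that R by (simp add: abs_divide)
      then have "- 1 \<le> s / R" "s / R \<le> 1" by linarith+
      moreover have "3 / 2 \<le> pi / 2" using pi_gt3 by simp
      ultimately have "arcsin (sin (s / R)) = s / R" by (intro arcsin_sin) linarith+
      moreover have "2 * y s - 1 = sin (s / R)" by (simp add: y_def add_divide_distrib)
      ultimately have "h (y s) = \<psi> s" using R by (simp add: h_def)
      then show ?thesis using N[OF order_refl y01[of s]] by (simp add: P_def[symmetric] abs_minus_commute)
    qed
  qed
qed

lemma continuous_antiderivative:
  fixes h :: "real \<Rightarrow> real"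
  assumes "continuous_on UNIV h"
  obtains H where "\<And>s. (H has_real_derivative h s) (at s)" "H 0 = 0"
proof -
  have "\<exists>F. \<forall>x::real. -\<infinity> < ereal x \<longrightarrow> ereal x < \<infinity> \<longrightarrow> (F has_vector_derivative h x) (at x)"
    by (rule einterval_antiderivative) (use assms in \<open>auto simp: continuous_on_eq_continuous_at\<close>)
  then obtain F where F: "\<And>x. (F has_vector_derivative h x) (at x)" by auto
  show ?thesis
    by (rule that[of "\<lambda>s. F s - F 0"])
      (use F in \<open>auto intro!: derivative_eq_intros simp: has_real_derivative_iff_has_vector_derivative\<close>)
qed

text \<open>
Only the values of \<open>\<psi>\<close> on the essential range of \<open>u\<close> matter, and that is bounded. So \<open>\<psi>\<close> may be
replaced by smooth bounded functions that approximate it uniformly there.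
\<close>
theorem energy_inequality:
  fixes \<Omega> :: "'a::euclidean_space set" and \<psi> \<Psi> \<Phi> :: "real \<Rightarrow> real"
  assumes n: "DIM('a) > 2" and \<Omega>: "open \<Omega>" "bounded \<Omega>" and sol: "weak_solution \<Omega> f u"
    and gm: "(\<lambda>x. f x (u x)) \<in> borel_measurable (lebesgue_on \<Omega>)"
    and gB: "AE x in lebesgue_on \<Omega>. \<bar>f x (u x)\<bar> \<le> Bg"
    and uR: "AE x in lebesgue_on \<Omega>. \<bar>u x\<bar> \<le> R"
    and \<psi>: "continuous_on UNIV \<psi>"
    and \<Psi>: "\<And>s. (\<Psi> has_real_derivative \<psi> s) (at s)" "\<Psi> 0 = 0"
    and \<Phi>: "\<And>s. (\<Phi> has_real_derivative (\<psi> s)\<^sup>2) (at s)" "\<Phi> 0 = 0"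
  defines "m \<equiv> real DIM('a)" and "q \<equiv> crit_exp DIM('a)"
  shows "(LINT x|lebesgue_on \<Omega>. \<bar>\<Psi> (u x)\<bar> powr q) powr (2 / q)
          \<le> (2 * (m - 1) / (m - 2))\<^sup>2 * (LINT x|lebesgue_on \<Omega>. f x (u x) * \<Phi> (u x))"
proof -
  let ?M = "lebesgue_on \<Omega>"
  interpret finite_measure ?M by (rule finite_measure_lebesgue_on_bounded_open[OF \<Omega>])
  define K where "K = max R 1"
  have K: "K > 0" and uK: "AE x in ?M. \<bar>u x\<bar> \<le> K"
    using uR by (auto simp: K_def elim!: eventually_mono)
  define e where "e k = 1 / (real k + 1)" for k
  have e: "0 < e k" "e k \<le> 1" for k by (auto simp: e_def)
  have e_lim: "e \<longlonglongrightarrow> 0" unfolding e_def using LIMSEQ_inverse_real_of_nat by (simp add: inverse_eq_divide add.commute)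
  have "\<exists>\<rho>. (\<forall>k. C_k k \<rho>) \<and> (\<exists>B. \<forall>s. \<bar>\<rho> s\<bar> \<le> B) \<and> (\<forall>s. \<bar>s\<bar> \<le> K \<longrightarrow> \<bar>\<rho> s - \<psi> s\<bar> \<le> e k)" for k
    using bounded_smooth_approximation[OF \<psi> K e(1)[of k]] by metis
  then obtain \<rho> where \<rho>: "\<And>k j. C_k j (\<rho> k)" "\<And>k. \<exists>B. \<forall>s. \<bar>\<rho> k s\<bar> \<le> B"
    "\<And>k s. \<bar>s\<bar> \<le> K \<Longrightarrow> \<bar>\<rho> k s - \<psi> s\<bar> \<le> e k" by metis
  have c\<rho>: "continuous_on UNIV (\<rho> k)" for k by (rule C_k_continuous[OF \<rho>(1)])
  have "\<exists>H. (\<forall>s. (H has_real_derivative \<rho> k s) (at s)) \<and> H 0 = 0" for k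
    using continuous_antiderivative[OF c\<rho>[of k]] by metis
  then obtain P where P: "\<And>k s. (P k has_real_derivative \<rho> k s) (at s)" "\<And>k. P k 0 = 0" by metis
  have "\<exists>H. (\<forall>s. (H has_real_derivative (\<rho> k s)\<^sup>2) (at s)) \<and> H 0 = 0" for k
    using continuous_antiderivative[OF continuous_on_power[OF c\<rho>[of k], of 2]] by metis
  then obtain Q where Q: "\<And>k s. (Q k has_real_derivative (\<rho> k s)\<^sup>2) (at s)" "\<And>k. Q k 0 = 0" by metis
  have "bounded (\<psi> ` {-K..K})"
    by (intro compact_imp_bounded compact_continuous_image continuous_on_subset[OF \<psi>]) auto
  then obtain C where C': "\<forall>y\<in>\<psi> ` {-K..K}. norm y \<le> C" unfolding bounded_iff by blast
  have C: "\<bar>\<psi> s\<bar> \<le> C" if "\<bar>s\<bar> \<le> K" for s using bspec[OF C' imageI[of s]] that by (auto simp: abs_le_iff)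
  have C0: "0 \<le> C" using C[of 0] K by auto
  have P_near: "\<bar>P k s - \<Psi> s\<bar> \<le> e k * K" if s: "\<bar>s\<bar> \<le> K" for k s
  proof -
    have "\<bar>P k s - \<Psi> s\<bar> \<le> e k * \<bar>s\<bar>"
      by (rule derivative_bound_imp_abs_le[where h = "\<lambda>s. \<rho> k s - \<psi> s" and R = K])
        (use P \<Psi> \<rho>(3) s K in \<open>auto intro!: derivative_intros\<close>)
    also have "\<dots> \<le> e k * K" using s e[of k] by (intro mult_left_mono) auto
    finally show ?thesis .
  qed
  have Q_near: "\<bar>Q k s - \<Phi> s\<bar> \<le> e k * (2 * C + 1) * K" if s: "\<bar>s\<bar> \<le> K" for k s
  proof -
    have "\<bar>Q k s - \<Phi> s\<bar> \<le> e k * (2 * C + 1) * \<bar>s\<bar>"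
    proof (rule derivative_bound_imp_abs_le[where h = "\<lambda>s. (\<rho> k s)\<^sup>2 - (\<psi> s)\<^sup>2" and R = K])
      fix t assume t: "\<bar>t\<bar> \<le> K"
      have 1: "\<bar>\<rho> k t - \<psi> t\<bar> \<le> e k" by (rule \<rho>(3)[OF t])
      then have 2: "\<bar>\<rho> k t + \<psi> t\<bar> \<le> 2 * C + 1" using C[OF t] e(2)[of k] by linarith
      have "(\<rho> k t)\<^sup>2 - (\<psi> t)\<^sup>2 = (\<rho> k t - \<psi> t) * (\<rho> k t + \<psi> t)" by (simp add: power2_eq_square algebra_simps)
      then show "\<bar>(\<rho> k t)\<^sup>2 - (\<psi> t)\<^sup>2\<bar> \<le> e k * (2 * C + 1)"
        using mult_mono[OF 1 2] e(1)[of k] by (simp add: abs_mult)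
    qed (use Q \<Phi> s K in \<open>auto intro!: derivative_intros\<close>)
    also have "\<dots> \<le> e k * (2 * C + 1) * K" using s e[of k] C0 by (intro mult_left_mono) auto
    finally show ?thesis .
  qed
  have um [measurable]: "u \<in> borel_measurable ?M" using sol by (auto simp: weak_solution_def H10_def Lp_def)
  note [measurable] = gm
  have "isCont \<Psi> s" "isCont \<Phi> s" "isCont (P k) s" "isCont (Q k) s" for s k
    using DERIV_isCont[OF \<Psi>(1)] DERIV_isCont[OF \<Phi>(1)] DERIV_isCont[OF P(1)] DERIV_isCont[OF Q(1)] by auto
  then have [measurable]: "\<Psi> \<in> borel_measurable borel" "\<Phi> \<in> borel_measurable borel"
     "P k \<in> borel_measurable borel" "Q k \<in> borel_measurable borel" for k
    by (auto intro!: borel_measurable_continuous_onI simp: continuous_on_eq_continuous_at)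
  have q: "q > 2" using n by (simp add: q_def crit_exp_def field_simps)
  have \<Psi>K: "\<bar>\<Psi> s\<bar> \<le> C * K" and \<Phi>K: "\<bar>\<Phi> s\<bar> \<le> C\<^sup>2 * K" if s: "\<bar>s\<bar> \<le> K" for s
  proof -
    have "\<bar>\<Psi> s\<bar> \<le> C * \<bar>s\<bar>" by (rule derivative_bound_imp_abs_le[OF \<Psi>, of K]) (use s K C in auto)
    also have "\<dots> \<le> C * K" using s C0 by (intro mult_left_mono) auto
    finally show "\<bar>\<Psi> s\<bar> \<le> C * K" .
    have "\<bar>\<Phi> s\<bar> \<le> C\<^sup>2 * \<bar>s\<bar>"
      by (rule derivative_bound_imp_abs_le[OF \<Phi>, of K]) (use s K C C0 in \<open>auto simp: abs_le_square_iff[symmetric]\<close>)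
    also have "\<dots> \<le> C\<^sup>2 * K" using s C0 by (intro mult_left_mono) auto
    finally show "\<bar>\<Phi> s\<bar> \<le> C\<^sup>2 * K" .
  qed
  have L1: "(\<lambda>k. LINT x|?M. \<bar>P k (u x)\<bar> powr q) \<longlonglongrightarrow> (LINT x|?M. \<bar>\<Psi> (u x)\<bar> powr q)"
  proof (rule integral_dominated_convergence[where w = "\<lambda>x. (C * K + K) powr q"])
    show "AE x in ?M. (\<lambda>k. \<bar>P k (u x)\<bar> powr q) \<longlonglongrightarrow> \<bar>\<Psi> (u x)\<bar> powr q"
      using uK
    proof eventually_elim
      case (elim x)
      have "(\<lambda>k. P k (u x) - \<Psi> (u x)) \<longlonglongrightarrow> 0"
        by (rule Lim_null_comparison[where g = "\<lambda>k. e k * K"])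
          (use P_near[OF elim] e_lim in \<open>auto intro!: tendsto_eq_intros\<close>)
      then have "(\<lambda>k. P k (u x)) \<longlonglongrightarrow> \<Psi> (u x)" by (simp add: LIM_zero_iff)
      then show ?case using q by (intro tendsto_powr' tendsto_intros) auto
    qed
    show "AE x in ?M. norm (\<bar>P k (u x)\<bar> powr q) \<le> (C * K + K) powr q" for k
      using uK
    proof eventually_elim
      case (elim x)
      have "e k * K \<le> 1 * K" using e[of k] K by (intro mult_right_mono) auto
      then have "\<bar>P k (u x)\<bar> \<le> C * K + K"
        using P_near[OF elim, of k] \<Psi>K[OF elim] by linarith
      then show ?case using q by (auto intro!: powr_mono2)
    qed
  qed auto
  have L2: "(\<lambda>k. LINT x|?M. f x (u x) * Q k (u x)) \<longlonglongrightarrow> (LINT x|?M. f x (u x) * \<Phi> (u x))"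
  proof (rule integral_dominated_convergence[where w = "\<lambda>x. \<bar>Bg\<bar> * (C\<^sup>2 * K + (2 * C + 1) * K)"])
    show "AE x in ?M. (\<lambda>k. f x (u x) * Q k (u x)) \<longlonglongrightarrow> f x (u x) * \<Phi> (u x)"
      using uK
    proof eventually_elim
      case (elim x)
      have "(\<lambda>k. Q k (u x) - \<Phi> (u x)) \<longlonglongrightarrow> 0"
        by (rule Lim_null_comparison[where g = "\<lambda>k. e k * (2 * C + 1) * K"])
          (use Q_near[OF elim] e_lim in \<open>auto intro!: tendsto_eq_intros\<close>)
      then have "(\<lambda>k. Q k (u x)) \<longlonglongrightarrow> \<Phi> (u x)" by (simp add: LIM_zero_iff)
      then show ?case by (intro tendsto_intros)
    qed
    show "AE x in ?M. norm (f x (u x) * Q k (u x)) \<le> \<bar>Bg\<bar> * (C\<^sup>2 * K + (2 * C + 1) * K)" for k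
      using uK gB
    proof eventually_elim
      case (elim x)
      have "e k * ((2 * C + 1) * K) \<le> 1 * ((2 * C + 1) * K)" using e[of k] K C0 by (intro mult_right_mono) auto
      then have "\<bar>Q k (u x)\<bar> \<le> C\<^sup>2 * K + (2 * C + 1) * K"
        using Q_near[OF elim(1), of k] \<Phi>K[OF elim(1)] by (simp add: mult.assoc)
      then show ?case using elim by (auto simp: abs_mult intro!: mult_mono)
    qed
  qed auto
  show ?thesis
  proof (rule LIMSEQ_le)
    show "(\<lambda>k. (LINT x|?M. \<bar>P k (u x)\<bar> powr q) powr (2 / q)) \<longlonglongrightarrow> (LINT x|?M. \<bar>\<Psi> (u x)\<bar> powr q) powr (2 / q)"
      using q by (intro tendsto_powr' L1 tendsto_intros) auto
    show "(\<lambda>k. (2 * (m - 1) / (m - 2))\<^sup>2 * (LINT x|?M. f x (u x) * Q k (u x)))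
        \<longlonglongrightarrow> (2 * (m - 1) / (m - 2))\<^sup>2 * (LINT x|?M. f x (u x) * \<Phi> (u x))"
      by (intro tendsto_intros L2)
    have "(LINT x|?M. \<bar>P k (u x)\<bar> powr q) powr (2 / q)
          \<le> (2 * (m - 1) / (m - 2))\<^sup>2 * (LINT x|?M. f x (u x) * Q k (u x))" for k
    proof -
      obtain B where B: "\<And>s. \<bar>\<rho> k s\<bar> \<le> B" using \<rho>(2)[of k] by blast
      show ?thesis unfolding m_def q_def
        by (rule energy_inequality_smooth[OF n \<Omega> sol gm gB \<rho>(1) B P Q])
    qed
    then show "\<exists>N. \<forall>k\<ge>N. (LINT x|?M. \<bar>P k (u x)\<bar> powr q) powr (2 / q)
          \<le> (2 * (m - 1) / (m - 2))\<^sup>2 * (LINT x|?M. f x (u x) * Q k (u x))" by blast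
  qed
qed


section \<open>Uniform higher integrability\<close>

lemma bounded_on_bounded_range:
  fixes f :: "'a::euclidean_space \<Rightarrow> real \<Rightarrow> real"
  assumes "bounded \<Omega>" "continuous_on (closure \<Omega> \<times> UNIV) (\<lambda>(x, s). f x s)"
  obtains B where "0 \<le> B" "\<And>x s. x \<in> closure \<Omega> \<Longrightarrow> \<bar>s\<bar> \<le> R \<Longrightarrow> \<bar>f x s\<bar> \<le> B"
proof -
  have "compact (closure \<Omega> \<times> {-R..R})"
    using assms(1) by (intro compact_Times) (auto simp: compact_closure)
  then have "bounded ((\<lambda>(x, s). f x s) ` (closure \<Omega> \<times> {-R..R}))"
    by (intro compact_imp_bounded compact_continuous_image continuous_on_subset[OF assms(2)]) auto
  then obtain B where B: "\<forall>y\<in>(\<lambda>(x, s). f x s) ` (closure \<Omega> \<times> {-R..R}). norm y \<le> B"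
    unfolding bounded_iff by blast
  show ?thesis
  proof (rule that[of "\<bar>B\<bar>"])
    fix x s assume "x \<in> closure \<Omega>" "\<bar>s\<bar> \<le> R"
    then have "f x s \<in> (\<lambda>(x, s). f x s) ` (closure \<Omega> \<times> {-R..R})" by (force simp: abs_le_iff)
    then have "norm (f x s) \<le> B" using B by blast
    then show "\<bar>f x s\<bar> \<le> \<bar>B\<bar>" by simp
  qed simp
qed

lemma bounded_solution_essential_bounds:
  fixes \<Omega> :: "'a::euclidean_space set"
  assumes \<Omega>: "open \<Omega>" "bounded \<Omega>" and f: "continuous_on (closure \<Omega> \<times> UNIV) (\<lambda>(x, s). f x s :: real)"
    and u: "u \<in> Linf \<Omega>"
  obtains R B where "u \<in> borel_measurable (lebesgue_on \<Omega>)" "AE x in lebesgue_on \<Omega>. \<bar>u x\<bar> \<le> R"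
    "(\<lambda>x. f x (u x)) \<in> borel_measurable (lebesgue_on \<Omega>)" "AE x in lebesgue_on \<Omega>. \<bar>f x (u x)\<bar> \<le> B"
proof -
  let ?M = "lebesgue_on \<Omega>"
  have um [measurable]: "u \<in> borel_measurable ?M" using u by (simp add: Linf_def)
  have lt: "Linf_norm \<Omega> u < \<infinity>" using u by (simp add: Linf_def)
  define R where "R = enn2real (Linf_norm \<Omega> u)"
  have "AE x in ?M. ennreal \<bar>u x\<bar> \<le> Linf_norm \<Omega> u" unfolding Linf_norm_def by (rule esssup_AE)
  then have uR: "AE x in ?M. \<bar>u x\<bar> \<le> R"
  proof eventually_elim
    case (elim x)
    then have "enn2real (ennreal \<bar>u x\<bar>) \<le> R" unfolding R_def by (intro enn2real_mono) (use lt in auto)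
    then show ?case by simp
  qed
  obtain B where B: "\<And>x s. x \<in> closure \<Omega> \<Longrightarrow> \<bar>s\<bar> \<le> R \<Longrightarrow> \<bar>f x s\<bar> \<le> B"
    using bounded_on_bounded_range[OF \<Omega>(2) f] by metis
  have gB: "AE x in ?M. \<bar>f x (u x)\<bar> \<le> B"
    using uR AE_space by eventually_elim (use B closure_subset in \<open>auto intro!: B\<close>)
  have gm: "(\<lambda>x. f x (u x)) \<in> borel_measurable ?M"
  proof -
    have idm: "(\<lambda>x. x) \<in> ?M \<rightarrow>\<^sub>M borel"
      using \<Omega>(1) by (intro continuous_imp_measurable_on_sets_lebesgue) (auto intro: continuous_intros)
    have pm: "(\<lambda>x. (x, u x)) \<in> ?M \<rightarrow>\<^sub>M borel"
      using borel_measurable_Pair[OF idm um] .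
    have "(\<lambda>x. (x, u x)) \<in> ?M \<rightarrow>\<^sub>M restrict_space borel (closure \<Omega> \<times> UNIV)"
      by (rule measurable_restrict_space2[OF _ pm]) (use closure_subset in auto)
    from measurable_compose[OF this borel_measurable_continuous_on_restrict[OF f]]
    show ?thesis by simp
  qed
  show ?thesis by (rule that[OF um uR gm gB])
qed

lemma pointwise_growth_of_sup_limit:
  fixes \<Omega> :: "'a::euclidean_space set"
  assumes "bounded \<Omega>" "continuous_on (closure \<Omega> \<times> UNIV) (\<lambda>(x, s). f x s :: real)"
    and lim: "((\<lambda>s. (SUP x\<in>closure \<Omega>. \<bar>f x s\<bar>) / \<bar>s\<bar> powr p) \<longlongrightarrow> 0) at_infinity"
    and \<epsilon>: "0 < \<epsilon>"
  shows "\<exists>R. \<forall>x\<in>closure \<Omega>. \<forall>s. R \<le> \<bar>s\<bar> \<longrightarrow> \<bar>f x s\<bar> \<le> \<epsilon> * \<bar>s\<bar> powr p"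
proof -
  have "eventually (\<lambda>s. (SUP x\<in>closure \<Omega>. \<bar>f x s\<bar>) / \<bar>s\<bar> powr p < \<epsilon>) at_infinity"
    by (rule order_tendstoD(2)[OF lim \<epsilon>])
  then obtain R where R: "\<And>s. R \<le> \<bar>s\<bar> \<Longrightarrow> (SUP x\<in>closure \<Omega>. \<bar>f x s\<bar>) / \<bar>s\<bar> powr p < \<epsilon>"
    by (auto simp: eventually_at_infinity)
  have "\<bar>f x s\<bar> \<le> \<epsilon> * \<bar>s\<bar> powr p" if x: "x \<in> closure \<Omega>" and s: "max R 1 \<le> \<bar>s\<bar>" for x s
  proof -
    obtain B where B: "\<And>x t. x \<in> closure \<Omega> \<Longrightarrow> \<bar>t\<bar> \<le> \<bar>s\<bar> \<Longrightarrow> \<bar>f x t\<bar> \<le> B"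
      using bounded_on_bounded_range[OF assms(1,2)] by metis
    have "\<bar>f x s\<bar> \<le> (SUP x\<in>closure \<Omega>. \<bar>f x s\<bar>)"
      by (rule cSUP_upper[OF x]) (use B in \<open>auto intro!: bdd_aboveI2[where M = B]\<close>)
    also have "\<dots> \<le> \<epsilon> * \<bar>s\<bar> powr p"
    proof -
      have "1 \<le> \<bar>s\<bar>" using s by simp
      then have "s \<noteq> 0" by auto
      then have "0 < \<bar>s\<bar> powr p" by simp
      moreover have "(SUP x\<in>closure \<Omega>. \<bar>f x s\<bar>) / \<bar>s\<bar> powr p < \<epsilon>" using R s by simp
      ultimately show ?thesis by (simp only: pos_divide_less_eq less_imp_le)
    qed
    finally show ?thesis .
  qed
  then show ?thesis by blast
qed

text \<open>
The energy inequality with \<open>\<Psi>(s) = s\<^bsup>m+1\<^esup>\<close>. Where \<open>|u| \<ge> R\<close> the integrand on its right is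
at most a constant times \<open>\<epsilon> |u|\<^bsup>q-2\<^esup> |u|\<^bsup>2(m+1)\<^esup>\<close>. Hoelder's inequality with
exponents \<open>1 - 2/q\<close> and \<open>2/q\<close> bounds the integral of this by a multiple of \<open>\<epsilon>\<close> times the left side, which
is absorbed. Where \<open>|u| \<le> R\<close> the integrand is bounded by a constant. The constant \<open>C\<close> depends on \<open>f\<close>, \<open>\<Omega>\<close>, \<open>A\<close> and \<open>m\<close>, but not on \<open>u\<close>.
\<close>
lemma powr_bound_of_critical_bound:
  fixes \<Omega> :: "'a::euclidean_space set"
  assumes n: "DIM('a) > 2" and \<Omega>: "open \<Omega>" "bounded \<Omega>"
    and f: "continuous_on (closure \<Omega> \<times> UNIV) (\<lambda>(x, s). f x s :: real)"
    and growth: "\<And>\<epsilon>. 0 < \<epsilon> \<Longrightarrow> \<exists>R. \<forall>x\<in>closure \<Omega>. \<forall>s. R \<le> \<bar>s\<bar> \<longrightarrow> \<bar>f x s\<bar> \<le> \<epsilon> * \<bar>s\<bar> powr (crit_exp DIM('a) - 1)"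
    and A: "0 \<le> A"
  defines "q \<equiv> crit_exp DIM('a)"
  shows "\<exists>C. \<forall>u. weak_solution \<Omega> f u \<longrightarrow> u \<in> Linf \<Omega> \<longrightarrow> (LINT x|lebesgue_on \<Omega>. \<bar>u x\<bar> powr q) \<le> A
      \<longrightarrow> (LINT x|lebesgue_on \<Omega>. \<bar>u x\<bar> powr (q * real (Suc m))) \<le> C"
proof -
  let ?M = "lebesgue_on \<Omega>"
  interpret finite_measure ?M by (rule finite_measure_lebesgue_on_bounded_open[OF \<Omega>])
  define N where "N = real DIM('a)"
  have N: "N > 2" using n by (simp add: N_def)
  have q: "q > 2" using n by (simp add: q_def crit_exp_def field_simps)
  define S where "S = (2 * (N - 1) / (N - 2))\<^sup>2"
  define L where "L = S * real (Suc m) ^ 2"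
  have S: "0 < S" using N by (auto simp: S_def intro!: zero_less_power divide_pos_pos)
  have L: "0 < L" using S by (simp add: L_def)
  \<comment> \<open>With this \<open>\<epsilon>\<close> the absorbed term is at most half of the left-hand side.\<close>
  define \<epsilon> where "\<epsilon> = 1 / (2 * L * (A powr (1 - 2 / q) + 1))"
  have Ap: "0 < A powr (1 - 2 / q) + 1" by (smt (verit) powr_ge_zero)
  have \<epsilon>: "0 < \<epsilon>" using L Ap by (simp add: \<epsilon>_def)
  obtain R0 where R0: "\<And>x s. x \<in> closure \<Omega> \<Longrightarrow> R0 \<le> \<bar>s\<bar> \<Longrightarrow> \<bar>f x s\<bar> \<le> \<epsilon> * \<bar>s\<bar> powr (q - 1)"
    using growth[OF \<epsilon>] unfolding q_def by blast
  define R where "R = max R0 1"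
  have R: "0 < R" "\<And>x s. x \<in> closure \<Omega> \<Longrightarrow> R \<le> \<bar>s\<bar> \<Longrightarrow> \<bar>f x s\<bar> \<le> \<epsilon> * \<bar>s\<bar> powr (q - 1)"
    using R0 by (auto simp: R_def)
  obtain B where B: "0 \<le> B" "\<And>x s. x \<in> closure \<Omega> \<Longrightarrow> \<bar>s\<bar> \<le> R \<Longrightarrow> \<bar>f x s\<bar> \<le> B"
    by (rule bounded_on_bounded_range[OF \<Omega>(2) f, of R], rule that)
  define p where "p = 2 * m + 1"
  define D where "D = B * R ^ p"
  have D0: "0 \<le> D" using B R by (simp add: D_def)
  have split: "\<bar>f x s\<bar> * \<bar>s\<bar> ^ p \<le> \<epsilon> * (\<bar>s\<bar> powr (q - 1) * \<bar>s\<bar> ^ p) + D" if x: "x \<in> closure \<Omega>" for x s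
  proof (cases "\<bar>s\<bar> \<le> R")
    case True
    then have "\<bar>f x s\<bar> * \<bar>s\<bar> ^ p \<le> D" unfolding D_def
      using B x R(1) by (intro mult_mono power_mono) auto
    moreover have "0 \<le> \<epsilon> * (\<bar>s\<bar> powr (q - 1) * \<bar>s\<bar> ^ p)" using \<epsilon> by simp
    ultimately show ?thesis by linarith
  next
    case False
    then have "\<bar>f x s\<bar> * \<bar>s\<bar> ^ p \<le> (\<epsilon> * \<bar>s\<bar> powr (q - 1)) * \<bar>s\<bar> ^ p"
      using R(2)[OF x, of s] by (intro mult_right_mono) auto
    then show ?thesis using D0 by (simp add: mult.assoc)
  qed
  define Z where "Z = 2 * L * (D * measure ?M (space ?M))"
  have main: "(LINT x|?M. \<bar>u x\<bar> powr (q * real (Suc m))) \<le> Z powr (q / 2)"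
    if sol: "weak_solution \<Omega> f u" and u: "u \<in> Linf \<Omega>" and uA: "(LINT x|?M. \<bar>u x\<bar> powr q) \<le> A" for u
  proof -
    obtain Ru Bu where um [measurable]: "u \<in> borel_measurable ?M" and uR: "AE x in ?M. \<bar>u x\<bar> \<le> Ru"
      and gm [measurable]: "(\<lambda>x. f x (u x)) \<in> borel_measurable ?M" and gB: "AE x in ?M. \<bar>f x (u x)\<bar> \<le> Bu"
      by (rule bounded_solution_essential_bounds[OF \<Omega> f u], rule that)
    have int: "integrable ?M (\<lambda>x. \<bar>u x\<bar> powr e)" if "0 \<le> e" for e
    proof (rule integrable_const_bound)
      show "AE x in ?M. norm (\<bar>u x\<bar> powr e) \<le> Ru powr e"
        using uR by eventually_elim (use that in \<open>auto intro: powr_mono2\<close>)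
    qed measurable
    define X where "X = (LINT x|?M. \<bar>u x\<bar> powr (q * real (Suc m)))"
    have X0: "0 \<le> X" by (simp add: X_def)
    define \<kappa> where "\<kappa> = real (Suc m) ^ 2 / real p"
    have \<kappa>: "0 \<le> \<kappa>" "\<kappa> \<le> real (Suc m) ^ 2" by (auto simp: \<kappa>_def p_def divide_le_eq)
    have energy: "(LINT x|?M. \<bar>u x ^ Suc m\<bar> powr q) powr (2 / q) \<le> S * (LINT x|?M. f x (u x) * (\<kappa> * u x ^ p))"
      unfolding S_def N_def q_def
    proof (rule energy_inequality[OF n \<Omega> sol gm gB uR, where \<psi> = "\<lambda>s. real (Suc m) * s ^ m"])
      show "((\<lambda>s. s ^ Suc m) has_real_derivative real (Suc m) * s ^ m) (at s)" for s :: real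
        using DERIV_pow[of "Suc m" s] by simp
      have "\<kappa> * (real p * s ^ (2 * m)) = (real (Suc m) * s ^ m)\<^sup>2" for s :: real
        by (simp add: \<kappa>_def p_def power_mult_distrib power_mult[symmetric] mult.commute)
      moreover have "((\<lambda>s. \<kappa> * s ^ p) has_real_derivative \<kappa> * (real p * s ^ (2 * m))) (at s)" for s :: real
        using DERIV_cmult[OF DERIV_pow[of p s], of \<kappa>] by (simp add: p_def)
      ultimately show "((\<lambda>s. \<kappa> * s ^ p) has_real_derivative (real (Suc m) * s ^ m)\<^sup>2) (at s)" for s :: real
        by simp
    qed (auto intro!: continuous_intros simp: p_def)
    have Xeq: "(LINT x|?M. \<bar>u x ^ Suc m\<bar> powr q) = X"
      unfolding X_def
    proof (intro Bochner_Integration.integral_cong refl)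
      fix x
      show "\<bar>u x ^ Suc m\<bar> powr q = \<bar>u x\<bar> powr (q * real (Suc m))"
        by (cases "u x = 0") (auto simp: power_abs powr_realpow[symmetric] powr_powr mult.commute simp del: power_Suc of_nat_Suc)
    qed
    define H where "H = (LINT x|?M. \<bar>u x\<bar> powr (q - 1) * \<bar>u x\<bar> ^ p)"
    have pw: "\<bar>s\<bar> powr (q - 1) * \<bar>s\<bar> ^ p = (\<Prod>j\<in>{0, 1::nat}. (if j = 0 then \<bar>s\<bar> powr q else \<bar>s\<bar> powr (q * real (Suc m))) powr (if j = 0 then 1 - 2 / q else 2 / q))" for s :: real
    proof (cases "s = 0")
      case False
      have e: "q * (1 - 2 / q) = q - 2" "q * real (Suc m) * (2 / q) = 2 * real (Suc m)"
        using q by (auto simp: field_simps)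
      have "\<bar>s\<bar> powr (q - 1) * \<bar>s\<bar> ^ p = \<bar>s\<bar> powr (q - 1 + real p)"
        using False by (simp add: powr_add powr_realpow)
      also have "q - 1 + real p = (q - 2) + 2 * real (Suc m)" by (simp add: p_def)
      also have "\<bar>s\<bar> powr \<dots> = (\<bar>s\<bar> powr q) powr (1 - 2 / q) * (\<bar>s\<bar> powr (q * real (Suc m))) powr (2 / q)"
        unfolding powr_powr e by (rule powr_add)
      finally show ?thesis by simp
    qed (use q in \<open>simp add: p_def\<close>)
    have H_le: "integrable ?M (\<lambda>x. \<bar>u x\<bar> powr (q - 1) * \<bar>u x\<bar> ^ p)" "H \<le> A powr (1 - 2 / q) * X powr (2 / q)"
    proof -
      note Hoe = Hoelder_real[of "{0, 1::nat}" "\<lambda>j. if j = 0 then 1 - 2 / q else 2 / q" ?M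
          "\<lambda>j x. if j = 0 then \<bar>u x\<bar> powr q else \<bar>u x\<bar> powr (q * real (Suc m))"]
      show "integrable ?M (\<lambda>x. \<bar>u x\<bar> powr (q - 1) * \<bar>u x\<bar> ^ p)"
        unfolding pw by (rule Hoe(1)) (use q int in auto)
      have "H \<le> (\<Prod>j\<in>{0, 1::nat}. (LINT x|?M. (if j = 0 then \<bar>u x\<bar> powr q else \<bar>u x\<bar> powr (q * real (Suc m)))) powr (if j = 0 then 1 - 2 / q else 2 / q))"
        unfolding H_def pw by (rule Hoe(2)) (use q int in auto)
      also have "\<dots> = (LINT x|?M. \<bar>u x\<bar> powr q) powr (1 - 2 / q) * X powr (2 / q)" by (simp add: X_def)
      also have "\<dots> \<le> A powr (1 - 2 / q) * X powr (2 / q)"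
        using uA q by (intro mult_right_mono powr_mono2) auto
      finally show "H \<le> A powr (1 - 2 / q) * X powr (2 / q)" .
    qed
    have "(LINT x|?M. f x (u x) * (\<kappa> * u x ^ p))
        \<le> (LINT x|?M. real (Suc m) ^ 2 * (\<epsilon> * (\<bar>u x\<bar> powr (q - 1) * \<bar>u x\<bar> ^ p) + D))"
    proof (rule integral_mono_AE)
      show "integrable ?M (\<lambda>x. f x (u x) * (\<kappa> * u x ^ p))"
      proof (rule integrable_const_bound)
        show "AE x in ?M. norm (f x (u x) * (\<kappa> * u x ^ p)) \<le> \<bar>Bu\<bar> * (\<kappa> * Ru ^ p)"
          using uR gB
        proof eventually_elim
          case (elim x)
          then have "\<bar>f x (u x)\<bar> * (\<kappa> * \<bar>u x\<bar> ^ p) \<le> \<bar>Bu\<bar> * (\<kappa> * Ru ^ p)"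
            using \<kappa>(1) by (intro mult_mono mult_left_mono power_mono mult_nonneg_nonneg) auto
          then show ?case using \<kappa>(1) by (simp add: abs_mult power_abs)
        qed
      qed measurable
      show "AE x in ?M. f x (u x) * (\<kappa> * u x ^ p) \<le> real (Suc m) ^ 2 * (\<epsilon> * (\<bar>u x\<bar> powr (q - 1) * \<bar>u x\<bar> ^ p) + D)"
      proof (rule AE_I2)
        fix x assume "x \<in> space ?M"
        then have x: "x \<in> closure \<Omega>" using closure_subset by auto
        have "f x (u x) * (\<kappa> * u x ^ p) \<le> \<bar>f x (u x) * (\<kappa> * u x ^ p)\<bar>" by (rule abs_ge_self)
        also have "\<dots> = \<kappa> * (\<bar>f x (u x)\<bar> * \<bar>u x\<bar> ^ p)" using \<kappa>(1) by (simp add: abs_mult power_abs)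
        also have "\<dots> \<le> real (Suc m) ^ 2 * (\<epsilon> * (\<bar>u x\<bar> powr (q - 1) * \<bar>u x\<bar> ^ p) + D)"
          using \<kappa> split[OF x, of "u x"] by (intro mult_mono) auto
        finally show "f x (u x) * (\<kappa> * u x ^ p) \<le> real (Suc m) ^ 2 * (\<epsilon> * (\<bar>u x\<bar> powr (q - 1) * \<bar>u x\<bar> ^ p) + D)" .
      qed
    qed (use H_le(1) in auto)
    also have "\<dots> = real (Suc m) ^ 2 * (\<epsilon> * H + D * measure ?M (space ?M))"
      using H_le(1) by (simp add: H_def mult.commute)
    finally have "X powr (2 / q) \<le> S * (real (Suc m) ^ 2 * (\<epsilon> * H + D * measure ?M (space ?M)))"
      using energy S unfolding Xeq by (meson mult_left_mono less_imp_le order_trans)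
    then have "X powr (2 / q) \<le> L * \<epsilon> * H + Z / 2"
      by (simp add: L_def Z_def algebra_simps del: of_nat_Suc)
    also have "L * \<epsilon> * H \<le> L * \<epsilon> * (A powr (1 - 2 / q) * X powr (2 / q))"
      using H_le(2) L \<epsilon> by (intro mult_left_mono) auto
    also have "\<dots> \<le> 1 / 2 * X powr (2 / q)"
    proof -
      have "L * \<epsilon> * A powr (1 - 2 / q) \<le> 1 / 2"
      proof -
        define Q where "Q = A powr (1 - 2 / q)"
        have Q: "0 \<le> Q" by (simp add: Q_def)
        have "L * (1 / (2 * L * e)) * Q = Q / (2 * e)" for e using L by simp
        then have "L * \<epsilon> * Q = Q / (2 * (Q + 1))" unfolding \<epsilon>_def Q_def .
        also have "\<dots> \<le> 1 / 2" using Q by (simp add: divide_le_eq)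
        finally show ?thesis by (simp add: Q_def)
      qed
      from mult_right_mono[OF this, of "X powr (2 / q)"] show ?thesis by (simp add: mult.assoc)
    qed
    finally have XZ: "X powr (2 / q) \<le> Z" by simp
    have "X = (X powr (2 / q)) powr (q / 2)" using q X0 by (simp add: powr_powr)
    also have "\<dots> \<le> Z powr (q / 2)" using XZ q by (intro powr_mono2) auto
    finally show ?thesis unfolding X_def .
  qed
  then show ?thesis by blast
qed


section \<open>From integrability of the right-hand side to a supremum bound\<close>

text \<open>
Along the levels \<open>k\<^sub>j = d (1 - 2\<^bsup>-j\<^esup>)\<close> the values \<open>A(k\<^sub>j)\<close> decay geometrically: since \<open>b > a\<close>, the
gain in the exponent of \<open>A(k\<^sub>j)\<close> compensates the factor \<open>2\<^sup>j\<close> lost in \<open>k\<^bsub>j+1\<^esub> - k\<^sub>j\<close>, provided that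
\<open>d\<close> is large enough.
\<close>
lemma stampacchia_vanishing:
  fixes A :: "real \<Rightarrow> real"
  assumes ab: "0 < a" "a < b" and c: "0 \<le> c" and V: "0 < V"
    and A: "\<And>k. 0 \<le> A k" "\<And>k h. k \<le> h \<Longrightarrow> A h \<le> A k" "A 0 \<le> V"
    and decay: "\<And>k h. 0 \<le> k \<Longrightarrow> k < h \<Longrightarrow> (h - k) * A h powr a \<le> c * A k powr b"
    and d: "0 < d" "c * V powr (b - a) * 2 powr (1 + a / (b - a)) \<le> d"
  shows "A d = 0"
proof -
  \<comment> \<open>The rate for which the powers of 2 depending on \<open>j\<close> cancel in the induction step.\<close>
  define \<mu> where "\<mu> = 1 / (b - a)"
  have \<mu>: "0 < \<mu>" "\<mu> * b = 1 + \<mu> * a" using ab by (auto simp: \<mu>_def field_simps)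
  define k where "k j = d * (1 - 2 powr (- real j))" for j
  have k0: "0 \<le> k j" "k j \<le> d" for j
    using d(1) powr_mono[of "- real j" 0 2] by (auto simp: k_def)
  have kstep: "k (Suc j) - k j = d * 2 powr (- real j - 1)" for j
  proof -
    define X :: real where "X = 2 powr (- real j - 1)"
    have "2 powr (- real j) = 2 * X" using powr_add[of 2 1 "- real j - 1"] by (simp add: X_def)
    then have "k j = d * (1 - 2 * X)" by (simp add: k_def)
    moreover have "k (Suc j) = d * (1 - X)" 
    proof -
      have "- real (Suc j) = - real j - 1" by simp
      then show ?thesis unfolding k_def X_def by presburger
    qed
    ultimately show ?thesis unfolding X_def[symmetric] by (simp add: algebra_simps)
  qed
  have bound: "A (k j) \<le> V * 2 powr (- (\<mu> * real j))" for j
  proof (induction j)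
    case 0
    then show ?case using A(3) by (simp add: k_def)
  next
    case (Suc j)
    have "k j < k (Suc j)" using kstep[of j] d(1) by (smt (verit) mult_pos_pos powr_gt_zero)
    then have "d * 2 powr (- real j - 1) * A (k (Suc j)) powr a \<le> c * A (k j) powr b"
      using decay[OF k0(1)[of j], of "k (Suc j)"] unfolding kstep by blast
    also have "\<dots> \<le> c * (V * 2 powr (- (\<mu> * real j))) powr b"
      using Suc.IH c A(1) ab by (intro mult_left_mono powr_mono2) auto
    also have "\<dots> = c * V powr b * 2 powr (- (\<mu> * b * real j))"
      using V by (simp add: powr_mult powr_powr mult_ac)
    also have "\<mu> * b * real j = real j + \<mu> * a * real j" by (simp add: \<mu> algebra_simps)
    also have "c * V powr b = (c * V powr (b - a) * 2 powr (1 + \<mu> * a)) * (V powr a * 2 powr (- (1 + \<mu> * a)))"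
    proof -
      have "V powr b = V powr (b - a) * V powr a" using powr_add[of V "b - a" a] by simp
      moreover have "2 powr (1 + \<mu> * a) * 2 powr (- (1 + \<mu> * a)) = (1 :: real)"
        by (simp only: powr_add[symmetric]) simp
      ultimately show ?thesis by (metis mult.assoc mult.left_commute mult.right_neutral)
    qed
    also have "\<dots> * 2 powr - (real j + \<mu> * a * real j)
        \<le> (d * (V powr a * 2 powr (- (1 + \<mu> * a)))) * 2 powr - (real j + \<mu> * a * real j)"
      using d(2) by (intro mult_right_mono) (auto simp: \<mu>_def)
    also have "\<dots> = d * 2 powr (- real j - 1) * (V powr a * 2 powr (- (\<mu> * a * real (Suc j))))"
    proof -
      have "- (1 + \<mu> * a) + - (real j + \<mu> * a * real j) = (- real j - 1) + - (\<mu> * a * real (Suc j))"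
        by (simp add: algebra_simps)
      then have "(2::real) powr (- (1 + \<mu> * a)) * 2 powr - (real j + \<mu> * a * real j)
          = 2 powr (- real j - 1) * 2 powr (- (\<mu> * a * real (Suc j)))"
        unfolding powr_add[symmetric] by presburger
      then show ?thesis by (simp only: mult.assoc mult.left_commute)
    qed
    finally have "A (k (Suc j)) powr a \<le> V powr a * 2 powr (- (\<mu> * a * real (Suc j)))"
      using d(1) by (simp add: mult_le_cancel_left_pos)
    also have "\<dots> = (V * 2 powr (- (\<mu> * real (Suc j)))) powr a"
      using V by (simp add: powr_mult powr_powr mult_ac)
    finally have le: "A (k (Suc j)) powr a \<le> (V * 2 powr (- (\<mu> * real (Suc j)))) powr a" .
    show ?case
    proof (rule ccontr)
      assume "\<not> ?case"
      then have "(V * 2 powr (- (\<mu> * real (Suc j)))) powr a < A (k (Suc j)) powr a"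
        using ab V by (intro powr_less_mono2) auto
      with le show False by simp
    qed
  qed
  have "(\<lambda>j. V * 2 powr (- (\<mu> * real j))) \<longlonglongrightarrow> 0"
  proof -
    have "(\<lambda>j. V * (2 powr (- \<mu>)) ^ j) \<longlonglongrightarrow> V * 0"
      using \<mu>(1) by (intro tendsto_mult_left LIMSEQ_power_zero) (simp add: powr_less_one)
    then show ?thesis by (simp add: powr_power mult.commute)
  qed
  moreover have "A d \<le> V * 2 powr (- (\<mu> * real j))" for j
    using bound[of j] A(2)[OF k0(2)[of j]] by linarith
  ultimately have "A d \<le> 0" by (intro LIMSEQ_le_const) auto
  then show ?thesis using A(1)[of d] by simp
qed

lemma positive_part_power_has_derivative:
  fixes x :: real
  shows "((\<lambda>x. max x 0 ^ Suc (Suc j)) has_real_derivative real (Suc (Suc j)) * max x 0 ^ Suc j) (at x)"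
proof -
  consider "x > 0" | "x < 0" | "x = 0" by linarith
  then show ?thesis
  proof cases
    case 1
    have "((\<lambda>x. x ^ Suc (Suc j)) has_real_derivative real (Suc (Suc j)) * max x 0 ^ Suc j) (at x)"
      using 1 DERIV_pow[of "Suc (Suc j)" x] by simp
    then show ?thesis
      by (rule has_field_derivative_transform_within_open[where S = "{0<..}"]) (use 1 in auto)
  next
    case 2
    have "((\<lambda>x. 0) has_real_derivative real (Suc (Suc j)) * max x 0 ^ Suc j) (at x)"
      using 2 by simp
    then show ?thesis
      by (rule has_field_derivative_transform_within_open[where S = "{..<0}"]) (use 2 in auto)
  next
    case 3
    have "((\<lambda>y. (max y 0 ^ Suc (Suc j) - max 0 0 ^ Suc (Suc j)) / (y - 0)) \<longlongrightarrow> 0) (at (0::real))"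
    proof (rule Lim_null_comparison[where g = "\<lambda>y. \<bar>y\<bar> ^ Suc j"], intro always_eventually allI)
      fix y :: real
      show "norm ((max y 0 ^ Suc (Suc j) - max 0 0 ^ Suc (Suc j)) / (y - 0)) \<le> \<bar>y\<bar> ^ Suc j"
      proof (cases "y > 0")
        case False
        then have "norm ((max y 0 ^ Suc (Suc j) - max 0 0 ^ Suc (Suc j)) / (y - 0)) = 0" by (simp add: max_def)
        then show ?thesis by (metis abs_ge_zero zero_le_power)
      qed (simp add: max_def)
      show "((\<lambda>y. \<bar>y\<bar> ^ Suc j) \<longlongrightarrow> 0) (at (0::real))" by (intro tendsto_eq_intros) auto
    qed
    then show ?thesis using 3 by (simp add: has_field_derivative_iff)
  qed
qed

text \<open>
Stampacchia's truncation method. With \<open>w = (|u| - k)\<^sup>+\<close> the energy inequality for \<open>|\<Psi>(u)| = w\<^sup>2\<close> bounds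
a norm of \<open>w\<close> by \<open>\<integral>|f(x, u)| w\<^sup>3\<close>. The integrand lives on the set \<open>U k\<close> where \<open>|u| > k\<close>, so Hoelder's
inequality yields a power of its measure \<open>A k\<close>. Chebyshev's inequality for \<open>w\<close> on \<open>U h\<close> then gives the
decay required in \<open>stampacchia_vanishing\<close>.
The square makes \<open>\<Psi>\<close> continuously differentiable, which the plain truncation is not.
\<close>
theorem sup_bound_of_rhs_bound:
  fixes \<Omega> :: "'a::euclidean_space set"
  assumes n: "DIM('a) > 2" and \<Omega>: "open \<Omega>" "bounded \<Omega>"
    and f: "continuous_on (closure \<Omega> \<times> UNIV) (\<lambda>(x, s). f x s :: real)"
    and \<Gamma>: "0 \<le> \<Gamma>"
  shows "\<exists>d>0. \<forall>u. weak_solution \<Omega> f u \<longrightarrow> u \<in> Linf \<Omega> \<longrightarrow>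
      (LINT x|lebesgue_on \<Omega>. \<bar>f x (u x)\<bar> powr real DIM('a)) \<le> \<Gamma> \<longrightarrow> (AE x in lebesgue_on \<Omega>. \<bar>u x\<bar> \<le> d)"
proof -
  let ?M = "lebesgue_on \<Omega>"
  interpret finite_measure ?M by (rule finite_measure_lebesgue_on_bounded_open[OF \<Omega>])
  define q where "q = crit_exp DIM('a)"
  define N where "N = real DIM('a)"
  have N: "N > 2" using n by (simp add: N_def)
  have q: "q = 2 * N / (N - 2)" by (simp add: q_def crit_exp_def N_def)
  have q2: "q > 2" using N by (simp add: q field_simps)
  define S where "S = (2 * (N - 1) / (N - 2))\<^sup>2"
  have S: "0 \<le> S" by (simp add: S_def)
  \<comment> \<open>Here \<open>a = 1/(2q)\<close>, and \<open>b\<close> is what is left for the measure of the level set when \<open>|f|\<close> takes the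
    exponent \<open>1/N\<close> and \<open>w\<^sup>3\<close> takes \<open>3a\<close>. That \<open>b > a\<close> makes the method work.\<close>
  define a where "a = (N - 2) / (4 * N)"
  define b where "b = (N + 2) / (4 * N)"
  have ab: "0 < a" "a < b" "1 / N + 3 * a + b = 1" "2 * q * a = 1" "2 / q = 4 * a"
    using N by (auto simp: a_def b_def q field_simps)
  define c where "c = 2 * S * \<Gamma> powr (1 / N)"
  have c: "0 \<le> c" using S by (simp add: c_def)
  \<comment> \<open>The summand 1 here and in \<open>d\<close> only keeps the constants positive when \<open>\<Omega>\<close> is empty or \<open>\<Gamma> = 0\<close>.\<close>
  define V where "V = measure ?M (space ?M) + 1"
  have V: "0 < V" by (simp add: V_def add_nonneg_pos)
  define d where "d = c * V powr (b - a) * 2 powr (1 + a / (b - a)) + 1"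
  have d: "0 < d" using c by (simp add: d_def add_nonneg_pos)
  have "AE x in ?M. \<bar>u x\<bar> \<le> d"
    if sol: "weak_solution \<Omega> f u" and u: "u \<in> Linf \<Omega>"
      and u\<Gamma>: "(LINT x|?M. \<bar>f x (u x)\<bar> powr N) \<le> \<Gamma>" for u
  proof -
    obtain R B where um [measurable]: "u \<in> borel_measurable ?M" and uR: "AE x in ?M. \<bar>u x\<bar> \<le> R"
      and gm [measurable]: "(\<lambda>x. f x (u x)) \<in> borel_measurable ?M" and gB: "AE x in ?M. \<bar>f x (u x)\<bar> \<le> B"
      by (rule bounded_solution_essential_bounds[OF \<Omega> f u], rule that)
    define U where "U k = {x \<in> space ?M. k < \<bar>u x\<bar>}" for k
    have sets: "U k \<in> sets ?M" for k unfolding U_def by measurable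
    have U_iff: "x \<in> U k \<longleftrightarrow> x \<in> space ?M \<and> k < \<bar>u x\<bar>" for x k by (simp add: U_def)
    have [simp]: "U k \<inter> \<Omega> = U k" for k by (auto simp: U_iff)
    define A where "A k = measure ?M (U k)" for k
    have Amono: "A h \<le> A k" if "k \<le> h" for k h
      unfolding A_def by (rule finite_measure_mono[OF _ sets]) (use that in \<open>auto simp: U_iff\<close>)
    have decay: "(h - k) * A h powr a \<le> c * A k powr b" if k: "0 \<le> k" "k < h" for k h
    proof -
      define w where "w x = max (\<bar>u x\<bar> - k) 0" for x
      have w0: "0 \<le> w x" for x by (simp add: w_def)
      have wm [measurable]: "w \<in> borel_measurable ?M" unfolding w_def by measurable
      have wR: "AE x in ?M. w x \<le> \<bar>R\<bar>" using uR by eventually_elim (use k in \<open>auto simp: w_def\<close>)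
      define P where "P s = max (s - k) 0" for s
      have P0: "P s = 0 \<or> P (- s) = 0" for s using k by (auto simp: P_def max_def)
      have dP: "((\<lambda>s. P s ^ Suc (Suc j)) has_real_derivative real (Suc (Suc j)) * P s ^ Suc j) (at s)" for s j
      proof -
        have "((\<lambda>s. s - k) has_real_derivative 1) (at s)" by (auto intro!: derivative_eq_intros)
        from DERIV_chain'[where g = "\<lambda>x. max x 0 ^ Suc (Suc j)", OF this positive_part_power_has_derivative]
        show ?thesis by (simp only: P_def mult_1_right)
      qed
      have dP': "((\<lambda>s. P (- s) ^ Suc (Suc j)) has_real_derivative - (real (Suc (Suc j)) * P (- s) ^ Suc j)) (at s)" for s j
      proof -
        have "(uminus has_real_derivative - 1) (at s)" by (auto intro!: derivative_eq_intros)
        from DERIV_chain'[where g = "\<lambda>s. P s ^ Suc (Suc j)", OF this dP]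
        show ?thesis by (simp only: mult_minus_right mult_1_right)
      qed
      \<comment> \<open>The functions \<open>\<Psi>\<close> and \<open>\<Phi>\<close> are odd, so that both signs of \<open>u\<close> are truncated at once; at most one of \<open>P s\<close>, \<open>P (- s)\<close>
        is nonzero, hence \<open>\<psi>\<^sup>2\<close> has no mixed term.\<close>
      define \<Psi> where "\<Psi> s = P s ^ 2 - P (- s) ^ 2" for s
      define \<Phi> where "\<Phi> s = 4 / 3 * (P s ^ 3 - P (- s) ^ 3)" for s
      define \<psi> where "\<psi> s = 2 * P s + 2 * P (- s)" for s
      have energy: "(LINT x|?M. \<bar>\<Psi> (u x)\<bar> powr q) powr (2 / q) \<le> S * (LINT x|?M. f x (u x) * \<Phi> (u x))"
        unfolding S_def N_def q_def
      proof (rule energy_inequality[OF n \<Omega> sol gm gB uR, where \<psi> = \<psi>])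
        show "continuous_on UNIV \<psi>" unfolding \<psi>_def P_def by (intro continuous_intros)
        show "(\<Psi> has_real_derivative \<psi> s) (at s)" for s
          unfolding \<Psi>_def \<psi>_def using DERIV_diff[OF dP[of 0 s] dP'[of 0 s]] by (simp add: numeral_2_eq_2)
        show "(\<Phi> has_real_derivative (\<psi> s)\<^sup>2) (at s)" for s
        proof -
          have "4 / 3 * (real (Suc (Suc 1)) * P s ^ Suc 1 - - (real (Suc (Suc 1)) * P (- s) ^ Suc 1)) = (\<psi> s)\<^sup>2"
            using P0[of s] by (auto simp: \<psi>_def power2_eq_square)
          then show ?thesis unfolding \<Phi>_def
            using DERIV_cmult[OF DERIV_diff[OF dP[of 1 s] dP'[of 1 s]], of "4 / 3"] by (simp add: numeral_3_eq_3)
        qed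
        show "\<Psi> 0 = 0" "\<Phi> 0 = 0" by (auto simp: \<Psi>_def \<Phi>_def)
      qed
      have \<Psi>w: "\<bar>\<Psi> (u x)\<bar> powr q = w x powr (2 * q)" for x
      proof -
        have "\<bar>\<Psi> (u x)\<bar> = w x ^ 2"
          using k by (auto simp: \<Psi>_def w_def P_def max_def abs_if)
        also have "\<dots> = w x powr 2" using w0[of x] by simp
        finally show ?thesis by (simp add: powr_powr)
      qed
      have \<Phi>w: "\<bar>\<Phi> (u x)\<bar> \<le> 2 * w x ^ 3" for x
        using k by (auto simp: \<Phi>_def w_def P_def max_def abs_if)
      define Y where "Y = (LINT x|?M. w x powr (2 * q))"
      have Y0: "0 \<le> Y" by (simp add: Y_def)
      have iY: "integrable ?M (\<lambda>x. w x powr (2 * q))"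
      proof (rule integrable_const_bound)
        show "AE x in ?M. norm (w x powr (2 * q)) \<le> \<bar>R\<bar> powr (2 * q)"
          using wR by eventually_elim (use q2 w0 in \<open>auto intro!: powr_mono2\<close>)
      qed measurable
      have ig: "integrable ?M (\<lambda>x. \<bar>f x (u x)\<bar> powr N)"
      proof (rule integrable_const_bound)
        show "AE x in ?M. norm (\<bar>f x (u x)\<bar> powr N) \<le> B powr N"
          using gB by eventually_elim (use N in \<open>auto intro!: powr_mono2\<close>)
      qed measurable
      have iA: "integrable ?M (\<lambda>x. indicator (U k) x :: real)"
        by (intro integrable_real_indicator sets) (simp add: emeasure_eq_measure)
      define F where "F j x = (if j = 0 then \<bar>f x (u x)\<bar> powr N else if j = 1 then w x powr (2 * q)
          else indicator (U k) x)" for j :: nat and x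
      define e where "e j = (if j = 0 then 1 / N else if j = 1 then 3 * a else b)" for j :: nat
      have Feq: "(\<Prod>j\<in>{0, 1, 2}. F j x powr e j) = \<bar>f x (u x)\<bar> * w x ^ 3" if x: "x \<in> space ?M" for x
      proof (cases "k < \<bar>u x\<bar>")
        case True
        then have wx: "0 < w x" by (simp add: w_def)
        have "2 * q * (3 * a) = 3" using ab(4) by (simp add: mult.assoc mult.left_commute)
        then have "(w x powr (2 * q)) powr (3 * a) = w x powr 3" unfolding powr_powr by (rule arg_cong)
        then have "(w x powr (2 * q)) powr (3 * a) = w x ^ 3" using wx by simp
        moreover have "(\<bar>f x (u x)\<bar> powr N) powr (1 / N) = \<bar>f x (u x)\<bar>" using N by (simp add: powr_powr)
        ultimately show ?thesis using True x by (simp add: F_def e_def U_iff)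
      next
        case False
        then have "w x = 0" by (simp add: w_def)
        then show ?thesis by (simp add: F_def e_def)
      qed
      have e: "0 < e j" for j using ab N by (auto simp: e_def)
      have e1: "(\<Sum>j\<in>{0, 1, 2}. e j) = 1" using ab(3) by (simp add: e_def)
      have iF: "integrable ?M (F j)" for j using ig iY iA by (cases "j = 0"; cases "j = 1") (simp_all add: F_def[abs_def])
      have F0: "0 \<le> F j x" for j x by (auto simp: F_def)
      have gw: "integrable ?M (\<lambda>x. \<bar>f x (u x)\<bar> * w x ^ 3)"
        using Hoelder_real(1)[of "{0, 1, 2::nat}" e ?M F] e e1 iF F0 Feq
        by (subst Bochner_Integration.integrable_cong[OF refl Feq[symmetric]]) auto
      have "(LINT x|?M. \<bar>f x (u x)\<bar> * w x ^ 3) = (LINT x|?M. (\<Prod>j\<in>{0, 1, 2}. F j x powr e j))"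
        by (rule Bochner_Integration.integral_cong[OF refl Feq[symmetric]])
      also have "\<dots> \<le> (\<Prod>j\<in>{0, 1, 2}. (LINT x|?M. F j x) powr e j)"
        by (rule Hoelder_real(2)) (use e e1 iF F0 in auto)
      also have "\<dots> = (LINT x|?M. \<bar>f x (u x)\<bar> powr N) powr (1 / N) * (Y powr (3 * a) * A k powr b)"
        by (simp add: F_def e_def Y_def A_def)
      also have "\<dots> \<le> \<Gamma> powr (1 / N) * (Y powr (3 * a) * A k powr b)"
        using u\<Gamma> N by (intro mult_right_mono powr_mono2) auto
      finally have Hoe: "(LINT x|?M. \<bar>f x (u x)\<bar> * w x ^ 3) \<le> \<Gamma> powr (1 / N) * (Y powr (3 * a) * A k powr b)" .
      have "(LINT x|?M. f x (u x) * \<Phi> (u x)) \<le> (LINT x|?M. 2 * (\<bar>f x (u x)\<bar> * w x ^ 3))"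
      proof (rule integral_mono')
        show "integrable ?M (\<lambda>x. 2 * (\<bar>f x (u x)\<bar> * w x ^ 3))" using gw by simp
        fix x
        have "f x (u x) * \<Phi> (u x) \<le> \<bar>f x (u x)\<bar> * \<bar>\<Phi> (u x)\<bar>" by (metis abs_ge_self abs_mult)
        also have "\<dots> \<le> \<bar>f x (u x)\<bar> * (2 * w x ^ 3)" by (intro mult_left_mono \<Phi>w) auto
        finally show "f x (u x) * \<Phi> (u x) \<le> 2 * (\<bar>f x (u x)\<bar> * w x ^ 3)" by simp
        show "0 \<le> 2 * (\<bar>f x (u x)\<bar> * w x ^ 3)" using w0 by simp
      qed
      also have "\<dots> \<le> 2 * (\<Gamma> powr (1 / N) * (Y powr (3 * a) * A k powr b))" using Hoe by simp
      finally have "S * (LINT x|?M. f x (u x) * \<Phi> (u x)) \<le> S * (2 * (\<Gamma> powr (1 / N) * (Y powr (3 * a) * A k powr b)))"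
        using S by (rule mult_left_mono)
      moreover have "Y powr (4 * a) \<le> S * (LINT x|?M. f x (u x) * \<Phi> (u x))"
        using energy unfolding \<Psi>w Y_def[symmetric] ab(5) .
      ultimately have YY: "Y powr (4 * a) \<le> c * A k powr b * Y powr (3 * a)"
        by (simp add: c_def mult_ac)
      have Ya: "Y powr a \<le> c * A k powr b"
      proof (cases "Y = 0")
        case True
        then show ?thesis using c by simp
      next
        case False
        with Y0 have "0 < Y powr (3 * a)" by simp
        moreover have "Y powr (4 * a) = Y powr a * Y powr (3 * a)" by (simp add: powr_add[symmetric])
        ultimately show ?thesis using YY by simp
      qed
      have "(h - k) powr (2 * q) * A h \<le> Y"
      proof -
        have "(h - k) powr (2 * q) * A h = (LINT x|?M. (h - k) powr (2 * q) * indicator (U h) x)"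
          by (simp add: A_def)
        also have "\<dots> \<le> Y" unfolding Y_def
        proof (rule integral_mono'[OF iY])
          fix x
          show "(h - k) powr (2 * q) * indicator (U h) x \<le> w x powr (2 * q)"
            using k q2 by (auto simp: indicator_def U_iff w_def intro!: powr_mono2)
        qed simp
        finally show ?thesis .
      qed
      then have "((h - k) powr (2 * q) * A h) powr a \<le> Y powr a"
        using ab by (intro powr_mono2) (auto simp: A_def)
      also have "((h - k) powr (2 * q) * A h) powr a = (h - k) * A h powr a"
        using k ab(4) by (simp add: powr_mult powr_powr A_def)
      finally show ?thesis using Ya by linarith
    qed
    have "A d = 0"
    proof (rule stampacchia_vanishing[where A = A and d = d, OF ab(1,2) c V])
      have "U 0 \<subseteq> space ?M" by (auto simp: U_iff)
      then have "measure ?M (U 0) \<le> measure ?M (space ?M)" by (rule finite_measure_mono) simp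
      then show "A 0 \<le> V" unfolding A_def V_def by linarith
    qed (use Amono decay d in \<open>auto simp: A_def d_def\<close>)
    then have "emeasure ?M (U d) = 0" unfolding A_def emeasure_eq_measure by simp
    then have "AE x in ?M. \<not> d < \<bar>u x\<bar>" by (intro AE_I[OF _ _ sets]) (auto simp: U_iff)
    then show ?thesis by (simp add: not_less)
  qed
  then show ?thesis using d unfolding N_def by blast
qed


section \<open>The uniform bound\<close>

text \<open>
Outside a bounded set of values \<open>s\<close>, \<open>|f(x, s)| \<le> |s|\<^bsup>q-1\<^esup>\<close>, so the \<open>N\<close>-th power of the right-hand side of the
equation is at most \<open>|u|\<^bsup>qN\<^esup>\<close> there, whose integral is controlled by \<open>powr_bound_of_critical_bound\<close>.
The exponent \<open>N\<close> is more than the \<open>N/2\<close> that a supremum bound requires.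
\<close>
theorem uniform_sup_bound:
  fixes \<Omega> :: "'a::euclidean_space set"
  assumes n: "DIM('a) > 2" and \<Omega>: "open \<Omega>" "bounded \<Omega>"
    and f: "continuous_on (closure \<Omega> \<times> UNIV) (\<lambda>(x, s). f x s :: real)"
    and lim: "((\<lambda>s. (SUP x\<in>closure \<Omega>. \<bar>f x s\<bar>) / \<bar>s\<bar> powr (crit_exp DIM('a) - 1)) \<longlongrightarrow> 0) at_infinity"
    and A: "0 \<le> A"
  shows "\<exists>d>0. \<forall>u. weak_solution \<Omega> f u \<longrightarrow> u \<in> Linf \<Omega> \<longrightarrow>
      (LINT x|lebesgue_on \<Omega>. \<bar>u x\<bar> powr crit_exp DIM('a)) \<le> A \<longrightarrow> (AE x in lebesgue_on \<Omega>. \<bar>u x\<bar> \<le> d)"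
proof -
  let ?M = "lebesgue_on \<Omega>"
  interpret finite_measure ?M by (rule finite_measure_lebesgue_on_bounded_open[OF \<Omega>])
  define q where "q = crit_exp DIM('a)"
  have q2: "q > 2" using n by (simp add: q_def crit_exp_def field_simps)
  define N where "N = real DIM('a)"
  have N: "N > 2" using n by (simp add: N_def)
  have sN: "real (Suc (DIM('a) - 1)) = N" using n by (simp add: N_def)
  note growth = pointwise_growth_of_sup_limit[OF \<Omega>(2) f lim]
  obtain C where C: "\<And>u. weak_solution \<Omega> f u \<Longrightarrow> u \<in> Linf \<Omega> \<Longrightarrow> (LINT x|?M. \<bar>u x\<bar> powr q) \<le> A
      \<Longrightarrow> (LINT x|?M. \<bar>u x\<bar> powr (q * N)) \<le> C"
    using powr_bound_of_critical_bound[OF n \<Omega> f growth A, of "DIM('a) - 1"] unfolding sN q_def by blast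
  obtain R0 where R0: "\<And>x s. x \<in> closure \<Omega> \<Longrightarrow> R0 \<le> \<bar>s\<bar> \<Longrightarrow> \<bar>f x s\<bar> \<le> 1 * \<bar>s\<bar> powr (q - 1)"
    using growth[of 1] unfolding q_def by force
  define R where "R = max R0 1"
  obtain B where B: "0 \<le> B" "\<And>x s. x \<in> closure \<Omega> \<Longrightarrow> \<bar>s\<bar> \<le> R \<Longrightarrow> \<bar>f x s\<bar> \<le> B"
    by (rule bounded_on_bounded_range[OF \<Omega>(2) f, of R], rule that)
  have pt: "\<bar>f x s\<bar> powr N \<le> B powr N + \<bar>s\<bar> powr (q * N)" if x: "x \<in> closure \<Omega>" for x s
  proof (cases "\<bar>s\<bar> \<le> R")
    case True
    then have "\<bar>f x s\<bar> powr N \<le> B powr N" using B x N by (intro powr_mono2) auto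
    then show ?thesis by (simp add: add_increasing2)
  next
    case False
    then have s: "1 \<le> \<bar>s\<bar>" "R0 \<le> \<bar>s\<bar>" by (auto simp: R_def)
    have "\<bar>f x s\<bar> powr N \<le> (\<bar>s\<bar> powr (q - 1)) powr N"
      using R0[OF x s(2)] N by (intro powr_mono2) auto
    also have "\<dots> \<le> \<bar>s\<bar> powr (q * N)"
      unfolding powr_powr using s(1) N by (intro powr_mono) auto
    finally show ?thesis by (simp add: add_increasing)
  qed
  define \<Gamma> where "\<Gamma> = \<bar>B powr N * measure ?M (space ?M) + C\<bar>"
  have \<Gamma>: "(LINT x|?M. \<bar>f x (u x)\<bar> powr N) \<le> \<Gamma>"
    if sol: "weak_solution \<Omega> f u" and u: "u \<in> Linf \<Omega>" and uA: "(LINT x|?M. \<bar>u x\<bar> powr q) \<le> A" for u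
  proof -
    obtain Ru Bu where um [measurable]: "u \<in> borel_measurable ?M" and uR: "AE x in ?M. \<bar>u x\<bar> \<le> Ru"
      by (rule bounded_solution_essential_bounds[OF \<Omega> f u], rule that)
    have int: "integrable ?M (\<lambda>x. \<bar>u x\<bar> powr (q * N))"
    proof (rule integrable_const_bound)
      show "AE x in ?M. norm (\<bar>u x\<bar> powr (q * N)) \<le> Ru powr (q * N)"
        using uR by eventually_elim (use q2 N in \<open>auto intro: powr_mono2\<close>)
    qed measurable
    have "(LINT x|?M. \<bar>f x (u x)\<bar> powr N) \<le> (LINT x|?M. B powr N + \<bar>u x\<bar> powr (q * N))"
    proof (rule integral_mono_AE')
      show "AE x in ?M. \<bar>f x (u x)\<bar> powr N \<le> B powr N + \<bar>u x\<bar> powr (q * N)"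
        by (rule AE_I2, rule pt) (use closure_subset in auto)
    qed (use int in auto)
    also have "\<dots> = B powr N * measure ?M (space ?M) + (LINT x|?M. \<bar>u x\<bar> powr (q * N))"
      using int by (simp add: mult.commute)
    also have "\<dots> \<le> \<Gamma>" using C[OF sol u uA] unfolding \<Gamma>_def by linarith
    finally show ?thesis .
  qed
  have "0 \<le> \<Gamma>" by (simp add: \<Gamma>_def)
  then obtain d where "0 < d" and d: "\<And>u. weak_solution \<Omega> f u \<Longrightarrow> u \<in> Linf \<Omega> \<Longrightarrow>
      (LINT x|?M. \<bar>f x (u x)\<bar> powr N) \<le> \<Gamma> \<Longrightarrow> (AE x in ?M. \<bar>u x\<bar> \<le> d)"
    using sup_bound_of_rhs_bound[OF n \<Omega> f, of \<Gamma>] unfolding N_def by blast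
  then show ?thesis using \<Gamma> unfolding q_def by blast
qed

theorem corollary2p2:
  fixes \<Omega> :: "(real ^ 'n) set"
    and f :: "real ^ 'n \<Rightarrow> real \<Rightarrow> real"
    and u :: "nat \<Rightarrow> real ^ 'n \<Rightarrow> real"
    and \<alpha> c0 M0 s0 C0 :: real
  assumes dim: "CARD('n) > 2"
    and \<Omega>: "open \<Omega>" "bounded \<Omega>" "connected \<Omega>"
    and \<alpha>: "0 < \<alpha>" "\<alpha> \<le> 1"
    and boundary: "C_2_hoelder_boundary \<alpha> \<Omega>"
    and f_cont: "continuous_on (closure \<Omega> \<times> UNIV) (\<lambda>(x, s). f x s)"
    and a: "((\<lambda>s. (SUP x\<in>closure \<Omega>. \<bar>f x s\<bar>) / \<bar>s\<bar> powr (crit_exp CARD('n) - 1))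
               \<longlongrightarrow> 0) at_infinity"
    and c0: "c0 > 0"
    and b: "Limsup at_top (\<lambda>s. ereal
               ((SUP (x, t)\<in>closure \<Omega> \<times> {-s..s}. \<bar>f x t\<bar>)
                  / (SUP (x, t)\<in>closure \<Omega> \<times> {-s, s}. \<bar>f x t\<bar>))) \<le> ereal c0"
    and M0_s0: "M0 > 0" "s0 > 0"
    and c: "\<And>s. \<bar>s\<bar> > s0 \<Longrightarrow> (SUP x\<in>closure \<Omega>. \<bar>f x s\<bar>) > M0"
    and u_space: "\<And>k. u k \<in> H10 \<Omega> \<inter> Linf \<Omega>"
    and u_sol: "\<And>k. weak_solution \<Omega> f (u k)"
    and C0: "C0 > 0"
    and u_bound: "\<And>k. Lp_norm \<Omega> (crit_exp CARD('n)) (u k) \<le> ennreal C0"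
  shows "\<exists>C>0. \<forall>k. Linf_norm \<Omega> (u k) \<le> ennreal C"
proof -
  let ?q = "crit_exp CARD('n)"
  have n: "DIM(real ^ 'n) > 2" using dim by simp
  have q: "?q > 0" using dim by (simp add: crit_exp_def)
  have um [measurable]: "u k \<in> borel_measurable (lebesgue_on \<Omega>)" for k
    using u_space[of k] by (simp add: Linf_def)
  have bound: "(LINT x|lebesgue_on \<Omega>. \<bar>u k x\<bar> powr ?q) \<le> C0 powr ?q" for k
  proof -
    have le: "(\<integral>\<^sup>+x. ennreal (\<bar>u k x\<bar> powr ?q) \<partial>lebesgue_on \<Omega>) \<le> ennreal (C0 powr ?q)"
      using Lp_norm_le_imp[OF u_bound[of k] less_imp_le[OF C0] q] by simp
    have "integrable (lebesgue_on \<Omega>) (\<lambda>x. \<bar>u k x\<bar> powr ?q)"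
      by (rule integrableI_bounded) (use le in \<open>auto intro: le_less_trans\<close>)
    then show ?thesis using le by (simp add: nn_integral_eq_integral)
  qed
  obtain d where "0 < d" and d: "\<And>v. weak_solution \<Omega> f v \<Longrightarrow> v \<in> Linf \<Omega> \<Longrightarrow>
      (LINT x|lebesgue_on \<Omega>. \<bar>v x\<bar> powr ?q) \<le> C0 powr ?q \<Longrightarrow> (AE x in lebesgue_on \<Omega>. \<bar>v x\<bar> \<le> d)"
    using uniform_sup_bound[OF n \<Omega>(1,2) f_cont, of "C0 powr ?q"] a by auto
  have "Linf_norm \<Omega> (u k) \<le> ennreal d" for k
    unfolding Linf_norm_def
  proof (rule esssup_I)
    have "AE x in lebesgue_on \<Omega>. \<bar>u k x\<bar> \<le> d"
      by (rule d[OF u_sol _ bound]) (use u_space in auto)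
    then show "AE x in lebesgue_on \<Omega>. ennreal \<bar>u k x\<bar> \<le> ennreal d"
      by eventually_elim (rule ennreal_leI)
  qed measurable
  with \<open>0 < d\<close> show ?thesis by blast
qed

end
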